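(* Let $\mathcal{Q}$ be a small quantaloid. The 2-functor $\mathsf K:\mathcal{Q}\text{-}\mathbf{Chu}\to\mathcal{Q}\text{-}\mathbf{Int}$ is a left inverse (i.e. $\mathsf K\mathsf I$ is the identity on $\mathcal{Q}\text{-}\mathbf{Int}$) and a right adjoint of the fully faithful 2-functor $\mathsf I:\mathcal{Q}\text{-}\mathbf{Int}\to\mathcal{Q}\text{-}\mathbf{Chu}$; hence, $\mathcal{Q}\text{-}\mathbf{Int}$ is a retract and a coreflective 2-subcategory of $\mathcal{Q}\text{-}\mathbf{Chu}$.
   Context: **Quantaloids.** A quantaloid is a category whose hom-sets are complete lattices and whose composition preserves arbitrary joins in each variable. For arrows $u:p\to q$, $v:q\to r$, $w:p\to r$ the arrows $w\swarrow u:q\to r$ and $v\searrow w:p\to q$ are determined by $v\circ u\le w\iff v\le w\swarrow u\iff u\le v\searrow w$. It is small if its objects form a set. Throughout, $\mathcal{Q}$ is a small quantaloid. **$\mathcal{Q}$-categories and $\mathcal{Q}$-distributors.** A $\mathcal{Q}$-category $X$ is a set $X$ with a type map $|\cdot|:X\to\mathrm{ob}\,\mathcal{Q}$ and hom-arrows $1_X^\natural(x,y)\in\mathcal{Q}(|x|,|y|)$ with $1_{|x|}\le 1_X^\natural(x,x)$ and $1_X^\natural(y,z)\circ 1_X^\natural(x,y)\le 1_X^\natural(x,z)$. Its underlying preorder is $x\le y\iff |x|=|y|$ and $1_{|x|}\le 1_X^\natural(x,y)$. A $\mathcal{Q}$-functor $f:X\to Y$ is a type-preserving map with $1_X^\natural(x,y)\le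 1_Y^\natural(fx,fy)$; $\mathcal{Q}$-functors are ordered pointwise ($f\le g$ iff $fx\le gx$ for all $x$), giving a locally ordered 2-category $\mathcal{Q}\text{-}\mathbf{Cat}$. A $\mathcal{Q}$-distributor $\phi:X\nrightarrow Y$ is a family $\phi(x,y)\in\mathcal{Q}(|x|,|y|)$ with $1_Y^\natural(y,y')\circ\phi(x,y)\circ 1_X^\natural(x',x)\le\phi(x',y')$. They form a quantaloid with pointwise order, $(\psi\circ\phi)(x,z)=\bigvee_y\psi(y,z)\circ\phi(x,y)$, identities $1_X^\natural$, and $(\xi\swarrow\phi)(y,z)=\bigwedge_x\xi(x,z)\swarrow\phi(x,y)$. A $\mathcal{Q}$-functor $f:X\to Y$ has graph $f_\natural:X\nrightarrow Y$, $f_\natural(x,y)=1_Y^\natural(fx,y)$. **Presheaves and Kan adjunctions.** $\{q\}$ is the one-object $\mathcal{Q}$-category of type $q$ with hom $1_q$. $\mathsf{P}X$ is the $\mathcal{Q}$-category of all $\mathcal{Q}$-distributors $\mu:X\nrightarrow\{q\}$ (of type $q$; $q\in\mathrm{ob}\,\mathcal{Q}$), with $1_{\mathsf{P}X}^\natural(\mu,\mu')=\mu'\swarrow\mu$; write $\mu(x)$ for its values. Each $\phi:X\nrightarrow Y$ induces an adjunction $\phi^*\dashv\phi_*$ of $\mathcal{Q}$-functors, $\phi^*:\mathsf{P}Y\to\mathsf{P}X$, $\phi^*\lambda=\lambda\circ\phi$, and $\phi_*:\mathsf{P}X\to\mathsf{P}Y$, $\phi_*\mu=\mu\swarrow\phi$.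 For a $\mathcal{Q}$-functor $f:X\to Y$ put $f^\leftarrow:=(f_\natural)^*:\mathsf{P}Y\to\mathsf{P}X$. **$\mathcal{Q}\text{-}\mathbf{Int}$.** A $\mathcal{Q}$-interior space $(X,a)$ is a $\mathcal{Q}$-category $X$ with a $\mathcal{Q}$-functor $a:\mathsf{P}X\to\mathsf{P}X$ such that $a\le 1_{\mathsf{P}X}$ and $aa=a$. $\mathcal{O}(X,a)=\{\mu\in\mathsf{P}X\mid a\mu=\mu\}$ is regarded as a full $\mathcal{Q}$-subcategory of $\mathsf{P}X$. A continuous $\mathcal{Q}$-functor $f:(X,a)\to(Y,b)$ is a $\mathcal{Q}$-functor $f:X\to Y$ with $f^\leftarrow b\le af^\leftarrow$. These form the 2-category $\mathcal{Q}\text{-}\mathbf{Int}$, with local order inherited from $\mathcal{Q}\text{-}\mathbf{Cat}$. **$\mathcal{Q}\text{-}\mathbf{Chu}$.** A Chu transform $(f,g):(\phi:X\nrightarrow Y)\to(\psi:X'\nrightarrow Y')$ is a pair of $\mathcal{Q}$-functors $f:X\to X'$, $g:Y'\to Y$ with $\psi(fx,y')=\phi(x,gy')$ for all $x\in X$, $y'\in Y'$. $\mathcal{Q}\text{-}\mathbf{Chu}$ is the locally ordered 2-category of $\mathcal{Q}$-distributors and Chu transforms, with $(f,g)\le(f',g')$ iff $f\le f'$ and $g\ge g'$. **$\mathsf K$ and $\mathsf I$.** $\mathsf K$ sends $\phi:X\nrightarrow Y$ to $(X,\phi^*\phi_* )$ and $(f,g):\phi\to\psi$ to $f:(X,\phi^*\phi_*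 )\to(X',\psi^*\psi_* )$. $\mathsf I$ sends $(X,a)$ to $\kappa_a:X\nrightarrow\mathcal{O}(X,a)$, $\kappa_a(x,\mu)=\mu(x)$, and a continuous $f:(X,a)\to(Y,b)$ to $(f,f^\leftarrow|_{\mathcal{O}(Y,b)}):\kappa_a\to\kappa_b$, where $f^\leftarrow|_{\mathcal{O}(Y,b)}:\mathcal{O}(Y,b)\to\mathcal{O}(X,a)$ is the restriction of $f^\leftarrow$. *)

theory Defs
  imports "HOL-Algebra.Complete_Lattice" "HOL-Library.FuncSet"
begin

section \<open>Locally ordered 2-categories and 2-functors\<close>

record ('o, 'm) ocat =
  obs :: "'o set"
  arrs :: "'m set"
  src :: "'m \<Rightarrow> 'o"
  tgt :: "'m \<Rightarrow> 'o"
  idn :: "'o \<Rightarrow> 'm"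
  cmp :: "'m \<Rightarrow> 'm \<Rightarrow> 'm"  (infixl \<open>\<bullet>\<index>\<close> 70)
  ale :: "'m \<Rightarrow> 'm \<Rightarrow> bool"  (infix \<open>\<preceq>\<index>\<close> 50)

definition Hom :: "('o, 'm) ocat \<Rightarrow> 'o \<Rightarrow> 'o \<Rightarrow> 'm set" where
  "Hom C p q = {u \<in> arrs C. src C u = p \<and> tgt C u = q}"

text \<open>Hom-sets are preordered; antisymmetry is not required, because the pointwise order of
  functors into a category enriched in a quantaloid is in general only a preorder.\<close>

locale ordered_category =
  fixes C :: "('o, 'm) ocat" (structure)
  assumes src_obs: "u \<in> arrs C \<Longrightarrow> src C u \<in> obs C"
    and tgt_obs: "u \<in> arrs C \<Longrightarrow> tgt C u \<in> obs C"
    and idn_Hom: "p \<in> obs C \<Longrightarrow> idn C p \<in> Hom C p p"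
    and cmp_Hom: "u \<in> Hom C p q \<Longrightarrow> v \<in> Hom C q r \<Longrightarrow> v \<bullet> u \<in> Hom C p r"
    and cmp_idn_right: "u \<in> Hom C p q \<Longrightarrow> u \<bullet> idn C p = u"
    and cmp_idn_left: "u \<in> Hom C p q \<Longrightarrow> idn C q \<bullet> u = u"
    and cmp_assoc: "u \<in> Hom C p q \<Longrightarrow> v \<in> Hom C q r \<Longrightarrow> w \<in> Hom C r s \<Longrightarrow>
                      w \<bullet> (v \<bullet> u) = (w \<bullet> v) \<bullet> u"
    and ale_refl: "u \<in> Hom C p q \<Longrightarrow> u \<preceq> u"
    and ale_trans: "u \<in> Hom C p q \<Longrightarrow> v \<in> Hom C p q \<Longrightarrow> w \<in> Hom C p q \<Longrightarrow>
                      u \<preceq> v \<Longrightarrow> v \<preceq> w \<Longrightarrow> u \<preceq> w"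
    and cmp_mono: "u \<in> Hom C p q \<Longrightarrow> u' \<in> Hom C p q \<Longrightarrow> v \<in> Hom C q r \<Longrightarrow> v' \<in> Hom C q r \<Longrightarrow>
                      u \<preceq> u' \<Longrightarrow> v \<preceq> v' \<Longrightarrow> v \<bullet> u \<preceq> v' \<bullet> u'"

record ('o, 'm, 'o2, 'm2) ofunctor =
  fobj :: "'o \<Rightarrow> 'o2"
  farr :: "'m \<Rightarrow> 'm2"

definition id_functor :: "('o, 'm, 'o, 'm) ofunctor" where
  "id_functor = \<lparr>fobj = (\<lambda>A. A), farr = (\<lambda>u. u)\<rparr>"

definition comp_functor ::
  "('o2, 'm2, 'o3, 'm3) ofunctor \<Rightarrow> ('o1, 'm1, 'o2, 'm2) ofunctor \<Rightarrow> ('o1, 'm1, 'o3, 'm3) ofunctor"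
where
  "comp_functor G F = \<lparr>fobj = fobj G \<circ> fobj F, farr = farr G \<circ> farr F\<rparr>"

text \<open>Values outside the objects and arrows of the domain are irrelevant.\<close>

definition functor_eq ::
  "('o, 'm) ocat \<Rightarrow> ('o, 'm, 'o2, 'm2) ofunctor \<Rightarrow> ('o, 'm, 'o2, 'm2) ofunctor \<Rightarrow> bool"
where
  "functor_eq C F G \<longleftrightarrow>
     (\<forall>A\<in>obs C. fobj F A = fobj G A) \<and> (\<forall>u\<in>arrs C. farr F u = farr G u)"

definition two_functor ::
  "('o, 'm) ocat \<Rightarrow> ('o2, 'm2) ocat \<Rightarrow> ('o, 'm, 'o2, 'm2) ofunctor \<Rightarrow> bool"
where
  "two_functor C D F \<longleftrightarrow>
     ordered_category C \<and> ordered_category D \<and>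
     (\<forall>A\<in>obs C. fobj F A \<in> obs D) \<and>
     (\<forall>A\<in>obs C. \<forall>B\<in>obs C. \<forall>u\<in>Hom C A B. farr F u \<in> Hom D (fobj F A) (fobj F B)) \<and>
     (\<forall>A\<in>obs C. farr F (idn C A) = idn D (fobj F A)) \<and>
     (\<forall>A\<in>obs C. \<forall>B\<in>obs C. \<forall>E\<in>obs C. \<forall>u\<in>Hom C A B. \<forall>v\<in>Hom C B E.
        farr F (v \<bullet>\<^bsub>C\<^esub> u) = farr F v \<bullet>\<^bsub>D\<^esub> farr F u) \<and>
     (\<forall>A\<in>obs C. \<forall>B\<in>obs C. \<forall>u\<in>Hom C A B. \<forall>v\<in>Hom C A B.
        u \<preceq>\<^bsub>C\<^esub> v \<longrightarrow> farr F u \<preceq>\<^bsub>D\<^esub> farr F v)"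

text \<open>Each hom-map is an isomorphism of preordered sets.\<close>

definition fully_faithful ::
  "('o, 'm) ocat \<Rightarrow> ('o2, 'm2) ocat \<Rightarrow> ('o, 'm, 'o2, 'm2) ofunctor \<Rightarrow> bool"
where
  "fully_faithful C D F \<longleftrightarrow>
     (\<forall>A\<in>obs C. \<forall>B\<in>obs C.
        bij_betw (farr F) (Hom C A B) (Hom D (fobj F A) (fobj F B)) \<and>
        (\<forall>u\<in>Hom C A B. \<forall>v\<in>Hom C A B. u \<preceq>\<^bsub>C\<^esub> v \<longleftrightarrow> farr F u \<preceq>\<^bsub>D\<^esub> farr F v))"

text \<open>There is at most one 2-cell between parallel arrows, so 2-naturality is naturality.\<close>

definition nat_transf ::
  "('o, 'm) ocat \<Rightarrow> ('o2, 'm2) ocat \<Rightarrow> ('o, 'm, 'o2, 'm2) ofunctor \<Rightarrow> ('o, 'm, 'o2, 'm2) ofunctor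
    \<Rightarrow> ('o \<Rightarrow> 'm2) \<Rightarrow> bool"
where
  "nat_transf C D F G \<eta> \<longleftrightarrow>
     (\<forall>A\<in>obs C. \<eta> A \<in> Hom D (fobj F A) (fobj G A)) \<and>
     (\<forall>A\<in>obs C. \<forall>B\<in>obs C. \<forall>u\<in>Hom C A B. farr G u \<bullet>\<^bsub>D\<^esub> \<eta> A = \<eta> B \<bullet>\<^bsub>D\<^esub> farr F u)"

definition two_adjunction ::
  "('o, 'm) ocat \<Rightarrow> ('o2, 'm2) ocat \<Rightarrow> ('o, 'm, 'o2, 'm2) ofunctor \<Rightarrow> ('o2, 'm2, 'o, 'm) ofunctor
    \<Rightarrow> bool"
where
  "two_adjunction C D F G \<longleftrightarrow>
     two_functor C D F \<and> two_functor D C G \<and>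
     (\<exists>\<eta> \<epsilon>.
        nat_transf C C id_functor (comp_functor G F) \<eta> \<and>
        nat_transf D D (comp_functor F G) id_functor \<epsilon> \<and>
        (\<forall>A\<in>obs C. \<epsilon> (fobj F A) \<bullet>\<^bsub>D\<^esub> farr F (\<eta> A) = idn D (fobj F A)) \<and>
        (\<forall>B\<in>obs D. farr G (\<epsilon> B) \<bullet>\<^bsub>C\<^esub> \<eta> (fobj G B) = idn C (fobj G B)))"

definition left_inverse ::
  "('o, 'm) ocat \<Rightarrow> ('o, 'm, 'o2, 'm2) ofunctor \<Rightarrow> ('o2, 'm2, 'o, 'm) ofunctor \<Rightarrow> bool"
where
  "left_inverse C F G \<longleftrightarrow> functor_eq C (comp_functor G F) id_functor"

definition retract_of :: "('o, 'm) ocat \<Rightarrow> ('o2, 'm2) ocat \<Rightarrow> bool" where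
  "retract_of C D \<longleftrightarrow>
     (\<exists>F G. two_functor C D F \<and> two_functor D C G \<and> left_inverse C F G)"

text \<open>\<open>C\<close> is identified with its image under the inclusion \<open>F\<close>: a full 2-subcategory
  whose inclusion has a right adjoint.\<close>

definition coreflective_via ::
  "('o, 'm) ocat \<Rightarrow> ('o2, 'm2) ocat \<Rightarrow> ('o, 'm, 'o2, 'm2) ofunctor \<Rightarrow> bool"
where
  "coreflective_via C D F \<longleftrightarrow>
     two_functor C D F \<and> inj_on (fobj F) (obs C) \<and> fully_faithful C D F \<and>
     (\<exists>G. two_adjunction C D F G)"


section \<open>Quantaloids\<close>

definition hom_lattice :: "('o, 'm) ocat \<Rightarrow> 'o \<Rightarrow> 'o \<Rightarrow> 'm gorder" where
  "hom_lattice Q p q = \<lparr>carrier = Hom Q p q, eq = (=), le = ale Q\<rparr>"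

locale quantaloid = ordered_category Q
  for Q :: "('o, 'm) ocat" (structure) +
  assumes hom_complete: "p \<in> obs Q \<Longrightarrow> q \<in> obs Q \<Longrightarrow> complete_lattice (hom_lattice Q p q)"
    and cmp_Sup_right: "p \<in> obs Q \<Longrightarrow> q \<in> obs Q \<Longrightarrow> r \<in> obs Q \<Longrightarrow>
          v \<in> Hom Q q r \<Longrightarrow> A \<subseteq> Hom Q p q \<Longrightarrow>
          v \<bullet> (\<Squnion>\<^bsub>hom_lattice Q p q\<^esub> A) = \<Squnion>\<^bsub>hom_lattice Q p r\<^esub> ((\<lambda>u. v \<bullet> u) ` A)"
    and cmp_Sup_left: "p \<in> obs Q \<Longrightarrow> q \<in> obs Q \<Longrightarrow> r \<in> obs Q \<Longrightarrow>
          u \<in> Hom Q p q \<Longrightarrow> A \<subseteq> Hom Q q r \<Longrightarrow>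
          (\<Squnion>\<^bsub>hom_lattice Q q r\<^esub> A) \<bullet> u = \<Squnion>\<^bsub>hom_lattice Q p r\<^esub> ((\<lambda>v. v \<bullet> u) ` A)"

text \<open>\<open>lres Q w u\<close> is the arrow \<open>w \<swarrow> u\<close>.\<close>

definition lres :: "('o, 'm) ocat \<Rightarrow> 'm \<Rightarrow> 'm \<Rightarrow> 'm" where
  "lres Q w u =
     (THE z. z \<in> Hom Q (tgt Q u) (tgt Q w) \<and>
        (\<forall>v\<in>Hom Q (tgt Q u) (tgt Q w). v \<bullet>\<^bsub>Q\<^esub> u \<preceq>\<^bsub>Q\<^esub> w \<longleftrightarrow> v \<preceq>\<^bsub>Q\<^esub> z))"


section \<open>Categories, functors and distributors over a quantaloid\<close>

text \<open>All functions below are \<open>undefined\<close> outside their domains, so that equality of the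
  formal objects is equality of the mathematical ones.\<close>

definition restrict2 :: "('a \<Rightarrow> 'b \<Rightarrow> 'c) \<Rightarrow> 'a set \<Rightarrow> 'b set \<Rightarrow> 'a \<Rightarrow> 'b \<Rightarrow> 'c" where
  "restrict2 f A B = (\<lambda>x y. if x \<in> A \<and> y \<in> B then f x y else undefined)"

definition extensional2 :: "'a set \<Rightarrow> 'b set \<Rightarrow> ('a \<Rightarrow> 'b \<Rightarrow> 'c) set" where
  "extensional2 A B = {f. \<forall>x y. \<not> (x \<in> A \<and> y \<in> B) \<longrightarrow> f x y = undefined}"

record ('a, 'o, 'm) qcat =
  pts :: "'a set"
  tp :: "'a \<Rightarrow> 'o"
  hm :: "'a \<Rightarrow> 'a \<Rightarrow> 'm"

definition qcategory :: "('o, 'm) ocat \<Rightarrow> ('a, 'o, 'm) qcat \<Rightarrow> bool" where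
  "qcategory Q X \<longleftrightarrow>
     tp X \<in> pts X \<rightarrow>\<^sub>E obs Q \<and>
     hm X \<in> extensional2 (pts X) (pts X) \<and>
     (\<forall>x\<in>pts X. \<forall>y\<in>pts X. hm X x y \<in> Hom Q (tp X x) (tp X y)) \<and>
     (\<forall>x\<in>pts X. idn Q (tp X x) \<preceq>\<^bsub>Q\<^esub> hm X x x) \<and>
     (\<forall>x\<in>pts X. \<forall>y\<in>pts X. \<forall>z\<in>pts X. hm X y z \<bullet>\<^bsub>Q\<^esub> hm X x y \<preceq>\<^bsub>Q\<^esub> hm X x z)"

text \<open>The underlying preorder of a category.\<close>

definition qle :: "('o, 'm) ocat \<Rightarrow> ('a, 'o, 'm) qcat \<Rightarrow> 'a \<Rightarrow> 'a \<Rightarrow> bool" where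
  "qle Q X x y \<longleftrightarrow> tp X x = tp X y \<and> idn Q (tp X x) \<preceq>\<^bsub>Q\<^esub> hm X x y"

definition qfunctor ::
  "('o, 'm) ocat \<Rightarrow> ('a, 'o, 'm) qcat \<Rightarrow> ('b, 'o, 'm) qcat \<Rightarrow> ('a \<Rightarrow> 'b) \<Rightarrow> bool"
where
  "qfunctor Q X Y f \<longleftrightarrow>
     f \<in> pts X \<rightarrow>\<^sub>E pts Y \<and>
     (\<forall>x\<in>pts X. tp Y (f x) = tp X x) \<and>
     (\<forall>x\<in>pts X. \<forall>y\<in>pts X. hm X x y \<preceq>\<^bsub>Q\<^esub> hm Y (f x) (f y))"

definition qfun_le ::
  "('o, 'm) ocat \<Rightarrow> ('a, 'o, 'm) qcat \<Rightarrow> ('b, 'o, 'm) qcat \<Rightarrow> ('a \<Rightarrow> 'b) \<Rightarrow> ('a \<Rightarrow> 'b) \<Rightarrow> bool"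
where
  "qfun_le Q X Y f g \<longleftrightarrow> (\<forall>x\<in>pts X. qle Q Y (f x) (g x))"

definition distributor ::
  "('o, 'm) ocat \<Rightarrow> ('a, 'o, 'm) qcat \<Rightarrow> ('b, 'o, 'm) qcat \<Rightarrow> ('a \<Rightarrow> 'b \<Rightarrow> 'm) \<Rightarrow> bool"
where
  "distributor Q X Y \<phi> \<longleftrightarrow>
     \<phi> \<in> extensional2 (pts X) (pts Y) \<and>
     (\<forall>x\<in>pts X. \<forall>y\<in>pts Y. \<phi> x y \<in> Hom Q (tp X x) (tp Y y)) \<and>
     (\<forall>x\<in>pts X. \<forall>x'\<in>pts X. \<forall>y\<in>pts Y. \<forall>y'\<in>pts Y.
        hm Y y y' \<bullet>\<^bsub>Q\<^esub> \<phi> x y \<bullet>\<^bsub>Q\<^esub> hm X x' x \<preceq>\<^bsub>Q\<^esub> \<phi> x' y')"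

text \<open>\<open>dist_comp Q X Y Z \<psi> \<phi>\<close> is \<open>\<psi> \<circ> \<phi>\<close>, and \<open>dist_lres Q X Y Z \<xi> \<phi>\<close> is \<open>\<xi> \<swarrow> \<phi>\<close>, where
  \<open>\<phi>\<close> is a distributor from \<open>X\<close> to \<open>Y\<close>, \<open>\<psi>\<close> one from \<open>Y\<close> to \<open>Z\<close>, and \<open>\<xi>\<close> one from \<open>X\<close> to \<open>Z\<close>.\<close>

definition dist_comp ::
  "('o, 'm) ocat \<Rightarrow> ('a, 'o, 'm) qcat \<Rightarrow> ('b, 'o, 'm) qcat \<Rightarrow> ('c, 'o, 'm) qcat
    \<Rightarrow> ('b \<Rightarrow> 'c \<Rightarrow> 'm) \<Rightarrow> ('a \<Rightarrow> 'b \<Rightarrow> 'm) \<Rightarrow> ('a \<Rightarrow> 'c \<Rightarrow> 'm)"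
where
  "dist_comp Q X Y Z \<psi> \<phi> =
     restrict2 (\<lambda>x z. \<Squnion>\<^bsub>hom_lattice Q (tp X x) (tp Z z)\<^esub> ((\<lambda>y. \<psi> y z \<bullet>\<^bsub>Q\<^esub> \<phi> x y) ` pts Y))
       (pts X) (pts Z)"

definition dist_lres ::
  "('o, 'm) ocat \<Rightarrow> ('a, 'o, 'm) qcat \<Rightarrow> ('b, 'o, 'm) qcat \<Rightarrow> ('c, 'o, 'm) qcat
    \<Rightarrow> ('a \<Rightarrow> 'c \<Rightarrow> 'm) \<Rightarrow> ('a \<Rightarrow> 'b \<Rightarrow> 'm) \<Rightarrow> ('b \<Rightarrow> 'c \<Rightarrow> 'm)"
where
  "dist_lres Q X Y Z \<xi> \<phi> =
     restrict2 (\<lambda>y z. \<Sqinter>\<^bsub>hom_lattice Q (tp Y y) (tp Z z)\<^esub> ((\<lambda>x. lres Q (\<xi> x z) (\<phi> x y)) ` pts X))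
       (pts Y) (pts Z)"

definition graph ::
  "('a, 'o, 'm) qcat \<Rightarrow> ('b, 'o, 'm) qcat \<Rightarrow> ('a \<Rightarrow> 'b) \<Rightarrow> ('a \<Rightarrow> 'b \<Rightarrow> 'm)"
where
  "graph X Y f = restrict2 (\<lambda>x y. hm Y (f x) y) (pts X) (pts Y)"


section \<open>Presheaves and Kan adjunctions\<close>

definition one_qcat :: "('o, 'm) ocat \<Rightarrow> 'o \<Rightarrow> (unit, 'o, 'm) qcat" where
  "one_qcat Q q = \<lparr>pts = {()}, tp = (\<lambda>_. q), hm = (\<lambda>_ _. idn Q q)\<rparr>"

text \<open>A presheaf carries its type: when \<open>X\<close> is empty, the type cannot be recovered from the
  distributor.\<close>

type_synonym ('a, 'o, 'm) psh = "'o \<times> ('a \<Rightarrow> unit \<Rightarrow> 'm)"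

definition pval :: "('a, 'o, 'm) psh \<Rightarrow> 'a \<Rightarrow> 'm" where
  "pval \<mu> x = snd \<mu> x ()"

definition PSh :: "('o, 'm) ocat \<Rightarrow> ('a, 'o, 'm) qcat \<Rightarrow> (('a, 'o, 'm) psh, 'o, 'm) qcat" where
  "PSh Q X =
     (let A = {(q, \<mu>). q \<in> obs Q \<and> distributor Q X (one_qcat Q q) \<mu>} in
      \<lparr>pts = A,
       tp = restrict fst A,
       hm = restrict2 (\<lambda>(q, \<mu>) (q', \<mu>'). dist_lres Q X (one_qcat Q q) (one_qcat Q q') \<mu>' \<mu> () ()) A A\<rparr>)"

text \<open>\<open>kan_up Q X Y \<phi>\<close> and \<open>kan_low Q X Y \<phi>\<close> are \<open>\<phi>\<^sup>*\<close> (from \<open>PSh Y\<close> to \<open>PSh X\<close>) and \<open>\<phi>\<^sub>*\<close> (from \<open>PSh X\<close> to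
  \<open>PSh Y\<close>) for a distributor \<open>\<phi>\<close> from \<open>X\<close> to \<open>Y\<close>.\<close>

definition kan_up ::
  "('o, 'm) ocat \<Rightarrow> ('a, 'o, 'm) qcat \<Rightarrow> ('b, 'o, 'm) qcat \<Rightarrow> ('a \<Rightarrow> 'b \<Rightarrow> 'm)
    \<Rightarrow> ('b, 'o, 'm) psh \<Rightarrow> ('a, 'o, 'm) psh"
where
  "kan_up Q X Y \<phi> = (\<lambda>(q, \<mu>) \<in> pts (PSh Q Y). (q, dist_comp Q X Y (one_qcat Q q) \<mu> \<phi>))"

definition kan_low ::
  "('o, 'm) ocat \<Rightarrow> ('a, 'o, 'm) qcat \<Rightarrow> ('b, 'o, 'm) qcat \<Rightarrow> ('a \<Rightarrow> 'b \<Rightarrow> 'm)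
    \<Rightarrow> ('a, 'o, 'm) psh \<Rightarrow> ('b, 'o, 'm) psh"
where
  "kan_low Q X Y \<phi> = (\<lambda>(q, \<mu>) \<in> pts (PSh Q X). (q, dist_lres Q X Y (one_qcat Q q) \<mu> \<phi>))"

text \<open>\<open>pullback Q X Y f\<close> is \<open>f\<^sup>\<leftarrow>\<close>, from \<open>PSh Y\<close> to \<open>PSh X\<close>.\<close>

definition pullback ::
  "('o, 'm) ocat \<Rightarrow> ('a, 'o, 'm) qcat \<Rightarrow> ('b, 'o, 'm) qcat \<Rightarrow> ('a \<Rightarrow> 'b)
    \<Rightarrow> ('b, 'o, 'm) psh \<Rightarrow> ('a, 'o, 'm) psh"
where
  "pullback Q X Y f = kan_up Q X Y (graph X Y f)"


section \<open>Interior spaces\<close>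

type_synonym ('a, 'o, 'm) ispace =
  "('a, 'o, 'm) qcat \<times> (('a, 'o, 'm) psh \<Rightarrow> ('a, 'o, 'm) psh)"

definition interior_space :: "('o, 'm) ocat \<Rightarrow> ('a, 'o, 'm) ispace \<Rightarrow> bool" where
  "interior_space Q = (\<lambda>(X, a).
     qcategory Q X \<and> qfunctor Q (PSh Q X) (PSh Q X) a \<and>
     qfun_le Q (PSh Q X) (PSh Q X) a (\<lambda>\<mu>\<in>pts (PSh Q X). \<mu>) \<and>
     compose (pts (PSh Q X)) a a = a)"

definition full_subcat :: "('a, 'o, 'm) qcat \<Rightarrow> 'a set \<Rightarrow> ('a, 'o, 'm) qcat" where
  "full_subcat X A = \<lparr>pts = A, tp = restrict (tp X) A, hm = restrict2 (hm X) A A\<rparr>"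

definition opens ::
  "('o, 'm) ocat \<Rightarrow> ('a, 'o, 'm) ispace \<Rightarrow> (('a, 'o, 'm) psh, 'o, 'm) qcat"
where
  "opens Q = (\<lambda>(X, a). full_subcat (PSh Q X) {\<mu> \<in> pts (PSh Q X). a \<mu> = \<mu>})"

definition continuous_functor ::
  "('o, 'm) ocat \<Rightarrow> ('a, 'o, 'm) ispace \<Rightarrow> ('b, 'o, 'm) ispace \<Rightarrow> ('a \<Rightarrow> 'b) \<Rightarrow> bool"
where
  "continuous_functor Q = (\<lambda>(X, a) (Y, b) f.
     qfunctor Q X Y f \<and>
     qfun_le Q (PSh Q Y) (PSh Q X)
       (compose (pts (PSh Q Y)) (pullback Q X Y f) b)
       (compose (pts (PSh Q Y)) a (pullback Q X Y f)))"

text \<open>The 2-category of interior spaces; \<open>\<U>\<close> is the class of admitted underlying sets.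
  An arrow is recorded together with its domain and codomain.\<close>

definition QInt ::
  "('o, 'm) ocat \<Rightarrow> 'a set set
    \<Rightarrow> (('a, 'o, 'm) ispace, ('a, 'o, 'm) ispace \<times> ('a \<Rightarrow> 'a) \<times> ('a, 'o, 'm) ispace) ocat"
where
  "QInt Q \<U> =
     (let Ob = {S. interior_space Q S \<and> pts (fst S) \<in> \<U>} in
      \<lparr>obs = Ob,
       arrs = {(S, f, T). S \<in> Ob \<and> T \<in> Ob \<and> continuous_functor Q S T f},
       src = (\<lambda>(S, f, T). S),
       tgt = (\<lambda>(S, f, T). T),
       idn = (\<lambda>S. (S, (\<lambda>x\<in>pts (fst S). x), S)),
       cmp = (\<lambda>(T, g, V) (S, f, _). (S, compose (pts (fst S)) g f, V)),
       ale = (\<lambda>(S, f, T) (_, g, _). qfun_le Q (fst S) (fst T) f g)\<rparr>)"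


section \<open>Distributors and Chu transforms\<close>

text \<open>The triple \<open>(X, \<phi>, Y)\<close> stands for the distributor \<open>\<phi>\<close> from \<open>X\<close> to \<open>Y\<close>.\<close>

type_synonym ('a, 'b, 'o, 'm) dist =
  "('a, 'o, 'm) qcat \<times> ('a \<Rightarrow> 'b \<Rightarrow> 'm) \<times> ('b, 'o, 'm) qcat"

definition chu_transform ::
  "('o, 'm) ocat \<Rightarrow> ('a, 'b, 'o, 'm) dist \<Rightarrow> ('c, 'd, 'o, 'm) dist
    \<Rightarrow> ('a \<Rightarrow> 'c) \<times> ('d \<Rightarrow> 'b) \<Rightarrow> bool"
where
  "chu_transform Q = (\<lambda>(X, \<phi>, Y) (X', \<psi>, Y') (f, g).
     qfunctor Q X X' f \<and> qfunctor Q Y' Y g \<and>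
     (\<forall>x\<in>pts X. \<forall>y'\<in>pts Y'. \<psi> (f x) y' = \<phi> x (g y')))"

definition dom_pts :: "('a, 'b, 'o, 'm) dist \<Rightarrow> 'a set" where
  "dom_pts = (\<lambda>(X, \<phi>, Y). pts X)"

definition cod_pts :: "('a, 'b, 'o, 'm) dist \<Rightarrow> 'b set" where
  "cod_pts = (\<lambda>(X, \<phi>, Y). pts Y)"

text \<open>The 2-category of distributors and Chu transforms; \<open>\<U>\<close> and \<open>\<V>\<close> are the classes of admitted
  underlying sets for domains and codomains of distributors.\<close>

definition QChu ::
  "('o, 'm) ocat \<Rightarrow> 'a set set \<Rightarrow> 'b set set
    \<Rightarrow> (('a, 'b, 'o, 'm) dist,
         ('a, 'b, 'o, 'm) dist \<times> (('a \<Rightarrow> 'a) \<times> ('b \<Rightarrow> 'b)) \<times> ('a, 'b, 'o, 'm) dist) ocat"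
where
  "QChu Q \<U> \<V> =
     (let Ob = {(X, \<phi>, Y). qcategory Q X \<and> qcategory Q Y \<and> distributor Q X Y \<phi> \<and>
                  pts X \<in> \<U> \<and> pts Y \<in> \<V>} in
      \<lparr>obs = Ob,
       arrs = {(\<Phi>, h, \<Psi>). \<Phi> \<in> Ob \<and> \<Psi> \<in> Ob \<and> chu_transform Q \<Phi> \<Psi> h},
       src = (\<lambda>(\<Phi>, h, \<Psi>). \<Phi>),
       tgt = (\<lambda>(\<Phi>, h, \<Psi>). \<Psi>),
       idn = (\<lambda>\<Phi>. (\<Phi>, (\<lambda>x\<in>dom_pts \<Phi>. x, \<lambda>y\<in>cod_pts \<Phi>. y), \<Phi>)),
       cmp = (\<lambda>(\<Psi>, (f', g'), \<Xi>) (\<Phi>, (f, g), _).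
                (\<Phi>, (compose (dom_pts \<Phi>) f' f, compose (cod_pts \<Xi>) g g'), \<Xi>)),
       ale = (\<lambda>((X, \<phi>, Y), (f, g), (X', \<psi>, Y')) (_, (f', g'), _).
                qfun_le Q X X' f f' \<and> qfun_le Q Y' Y g' g)\<rparr>)"


section \<open>Universes\<close>

text \<open>HOL has no type of all sets, so the sets underlying categories are subsets of a type \<open>'a\<close>
  (domains of distributors) or \<open>'b\<close> (codomains of distributors), taken from classes \<open>\<U>\<close> and \<open>\<V>\<close>.
  The codomain of the distributor assigned to an interior space on \<open>X\<close> is a set of presheaves on \<open>X\<close>,
  hence \<open>\<V>\<close> must contain a copy of every such set; the copies are given by an injective encoding \<open>e\<close>.
  The case \<open>\<U> = \<V>\<close> on a single type is that of a universe of sets closed under forming presheaf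
  categories. In general \<open>\<U>\<close> may consist of all subsets of an arbitrary type \<open>'a\<close>, and \<open>\<V>\<close> of all
  subsets of any type that is large enough, such as the type of presheaves, with \<open>e\<close> the identity,
  or the sum of this type with any other one.\<close>

definition admits_presheaves ::
  "('o, 'm) ocat \<Rightarrow> 'a set set \<Rightarrow> 'b set set \<Rightarrow> (('a, 'o, 'm) psh \<Rightarrow> 'b) \<Rightarrow> bool"
where
  "admits_presheaves Q \<U> \<V> e \<longleftrightarrow>
     (\<forall>X. qcategory Q X \<and> pts X \<in> \<U> \<longrightarrow>
        inj_on e (pts (PSh Q X)) \<and> (\<forall>A \<subseteq> pts (PSh Q X). e ` A \<in> \<V>))"

lemma admits_presheaves_id: "admits_presheaves Q UNIV UNIV (\<lambda>\<mu>. \<mu>)"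
  and admits_presheaves_Inl: "admits_presheaves Q UNIV UNIV Inl"
  by (auto simp: admits_presheaves_def)

text \<open>The isomorphic copy of a category along an injection.\<close>

definition copy :: "('a \<Rightarrow> 'b) \<Rightarrow> ('a, 'o, 'm) qcat \<Rightarrow> ('b, 'o, 'm) qcat" where
  "copy e X =
     (let A = e ` pts X; d = inv_into (pts X) e in
      \<lparr>pts = A,
       tp = (\<lambda>y\<in>A. tp X (d y)),
       hm = restrict2 (\<lambda>y y'. hm X (d y) (d y')) A A\<rparr>)"


section \<open>The 2-functors \<open>K\<close> and \<open>I\<close>\<close>

definition K_obj :: "('o, 'm) ocat \<Rightarrow> ('a, 'b, 'o, 'm) dist \<Rightarrow> ('a, 'o, 'm) ispace" where
  "K_obj Q = (\<lambda>(X, \<phi>, Y). (X, compose (pts (PSh Q X)) (kan_up Q X Y \<phi>) (kan_low Q X Y \<phi>)))"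

definition K_functor ::
  "('o, 'm) ocat \<Rightarrow>
    (('a, 'b, 'o, 'm) dist,
     ('a, 'b, 'o, 'm) dist \<times> (('a \<Rightarrow> 'a) \<times> ('b \<Rightarrow> 'b)) \<times> ('a, 'b, 'o, 'm) dist,
     ('a, 'o, 'm) ispace,
     ('a, 'o, 'm) ispace \<times> ('a \<Rightarrow> 'a) \<times> ('a, 'o, 'm) ispace) ofunctor"
where
  "K_functor Q = \<lparr>fobj = K_obj Q, farr = (\<lambda>(\<Phi>, (f, g), \<Psi>). (K_obj Q \<Phi>, f, K_obj Q \<Psi>))\<rparr>"

text \<open>For injective \<open>e\<close> this is \<open>\<kappa>\<^sub>a\<close> and \<open>f\<^sup>\<leftarrow>\<close>, restricted to open presheaves, up to renaming the
  open presheaves along \<open>e\<close>; it is literally these when \<open>e\<close> is the identity.\<close>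

definition I_obj ::
  "('o, 'm) ocat \<Rightarrow> (('a, 'o, 'm) psh \<Rightarrow> 'b) \<Rightarrow> ('a, 'o, 'm) ispace \<Rightarrow> ('a, 'b, 'o, 'm) dist"
where
  "I_obj Q e S =
     (let X = fst S; A = pts (opens Q S) in
      (X, restrict2 (\<lambda>x m. pval (inv_into A e m) x) (pts X) (e ` A), copy e (opens Q S)))"

definition I_arr ::
  "('o, 'm) ocat \<Rightarrow> (('a, 'o, 'm) psh \<Rightarrow> 'b) \<Rightarrow>
    ('a, 'o, 'm) ispace \<times> ('a \<Rightarrow> 'a) \<times> ('a, 'o, 'm) ispace \<Rightarrow>
    ('a, 'b, 'o, 'm) dist \<times> (('a \<Rightarrow> 'a) \<times> ('b \<Rightarrow> 'b)) \<times> ('a, 'b, 'o, 'm) dist"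
where
  "I_arr Q e = (\<lambda>(S, f, T).
     (let A = pts (opens Q T) in
      (I_obj Q e S,
       (f, \<lambda>m \<in> e ` A. e (pullback Q (fst S) (fst T) f (inv_into A e m))),
       I_obj Q e T)))"

definition I_functor ::
  "('o, 'm) ocat \<Rightarrow> (('a, 'o, 'm) psh \<Rightarrow> 'b) \<Rightarrow>
    (('a, 'o, 'm) ispace,
     ('a, 'o, 'm) ispace \<times> ('a \<Rightarrow> 'a) \<times> ('a, 'o, 'm) ispace,
     ('a, 'b, 'o, 'm) dist,
     ('a, 'b, 'o, 'm) dist \<times> (('a \<Rightarrow> 'a) \<times> ('b \<Rightarrow> 'b)) \<times> ('a, 'b, 'o, 'm) dist) ofunctor"
where
  "I_functor Q e = \<lparr>fobj = I_obj Q e, farr = I_arr Q e\<rparr>"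

end

theory Submission
  imports Defs
begin

text \<open>A continuous functor \<open>f\<close> pulls open presheaves back to open presheaves, and a Chu transform
  \<open>(f, g)\<close> from \<open>\<kappa>\<^sub>a\<close> to \<open>\<kappa>\<^sub>b\<close> satisfies \<open>\<mu>(f x) = (g \<mu>)(x)\<close>, that is, \<open>g = f\<^sup>\<leftarrow>\<close>; hence \<open>I\<close> is fully
  faithful. Since \<open>K I\<close> is the identity, so is the unit. The counit at \<open>\<phi>\<close> is the identity on \<open>X\<close>
  paired with \<open>y \<mapsto> \<phi>(-, y)\<close>; the presheaf \<open>\<phi>(-, y)\<close> is open for \<open>\<phi>\<^sup>*\<phi>\<^sub>*\<close> because the identity
  lies below \<open>(\<phi>\<^sub>* \<phi>(-, y))(y)\<close>.\<close>

section \<open>Quantaloids\<close>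

text \<open>Local orders are only preorders, yet \<open>K I\<close> has to be the identity on the
  nose. This is possible because P X is separated: its order is pointwise and the hom-sets of a
  quantaloid are antisymmetric, so two inequalities between presheaves yield an equality. Residuals,
  joins and meets therefore mostly enter through their universal properties, and presheaves are
  compared by type and by values. The operator \<open>\<phi>\<^sup>*\<phi>\<^sub>*\<close> is the
  comonad of a Kan adjunction, hence an interior operator. \<open>K\<close> is defined on a Chu
  transform \<open>(f, g)\<close> because the Chu condition carries the term at y' of the join for
  \<psi> below the term at g y' of the join for \<phi>. The presheaf \<phi>(-, y) in the counit is
  the image under \<open>\<phi>\<^sup>*\<close> of the representable presheaf Y(-, y), and every
  presheaf in the image of \<open>\<phi>\<^sup>*\<close> is fixed by
  \<open>\<phi>\<^sup>*\<phi>\<^sub>*\<close>. Fullness of \<open>I\<close> rests on the equivalence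
  of continuity with the preservation of open presheaves by inverse images.\<close>

context quantaloid
begin

lemma Hom_obs: "u \<in> Hom Q p q \<Longrightarrow> p \<in> obs Q \<and> q \<in> obs Q"
  using src_obs tgt_obs by (auto simp: Hom_def)

text \<open>\<open>ordered_category\<close> only gives a preorder; antisymmetry comes from the
  lattice structure of the hom-sets, whose equality \<open>eq\<close> is \<open>(=)\<close>.\<close>

lemma ale_antisym:
  assumes "u \<in> Hom Q p q" "v \<in> Hom Q p q" "u \<preceq> v" "v \<preceq> u"
  shows "u = v"
proof -
  interpret L: complete_lattice "hom_lattice Q p q"
    using hom_complete Hom_obs assms(1) by blast
  show ?thesis using L.le_antisym assms by (simp add: hom_lattice_def)
qed

lemma cmp_mono_right:
  assumes "u \<in> Hom Q p q" "u' \<in> Hom Q p q" "v \<in> Hom Q q r" "u \<preceq> u'"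
  shows "v \<bullet> u \<preceq> v \<bullet> u'"
  using assms cmp_mono ale_refl by blast

lemma cmp_mono_left:
  assumes "u \<in> Hom Q p q" "v \<in> Hom Q q r" "v' \<in> Hom Q q r" "v \<preceq> v'"
  shows "v \<bullet> u \<preceq> v' \<bullet> u"
  using assms cmp_mono ale_refl by blast

lemma Sup_Hom:
  assumes "p \<in> obs Q" "q \<in> obs Q" "A \<subseteq> Hom Q p q"
  shows "\<Squnion>\<^bsub>hom_lattice Q p q\<^esub> A \<in> Hom Q p q"
proof -
  interpret L: complete_lattice "hom_lattice Q p q" using hom_complete assms by blast
  show ?thesis using L.sup_closed[of A] assms by (simp add: hom_lattice_def)
qed

lemma Sup_le_iff:
  assumes "p \<in> obs Q" "q \<in> obs Q" "A \<subseteq> Hom Q p q" "w \<in> Hom Q p q"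
  shows "\<Squnion>\<^bsub>hom_lattice Q p q\<^esub> A \<preceq> w \<longleftrightarrow> (\<forall>u\<in>A. u \<preceq> w)"
proof -
  interpret L: complete_lattice "hom_lattice Q p q" using hom_complete assms by blast
  have *: "\<And>u. u \<in> A \<Longrightarrow> u \<preceq> \<Squnion>\<^bsub>hom_lattice Q p q\<^esub> A"
    using L.sup_upper[of A] assms by (simp add: hom_lattice_def)
  have "(\<forall>u\<in>A. u \<preceq> w) \<Longrightarrow> \<Squnion>\<^bsub>hom_lattice Q p q\<^esub> A \<preceq> w"
    using L.sup_least[of A w] assms by (simp add: hom_lattice_def Upper_def subset_iff)
  then show ?thesis using assms * Sup_Hom[OF assms(1-3)] ale_trans by blast
qed

lemma Inf_Hom:
  assumes "p \<in> obs Q" "q \<in> obs Q" "A \<subseteq> Hom Q p q"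
  shows "\<Sqinter>\<^bsub>hom_lattice Q p q\<^esub> A \<in> Hom Q p q"
proof -
  interpret L: complete_lattice "hom_lattice Q p q" using hom_complete assms by blast
  show ?thesis using L.inf_closed[of A] assms by (simp add: hom_lattice_def)
qed

lemma le_Inf_iff:
  assumes "p \<in> obs Q" "q \<in> obs Q" "A \<subseteq> Hom Q p q" "w \<in> Hom Q p q"
  shows "w \<preceq> \<Sqinter>\<^bsub>hom_lattice Q p q\<^esub> A \<longleftrightarrow> (\<forall>u\<in>A. w \<preceq> u)"
proof -
  interpret L: complete_lattice "hom_lattice Q p q" using hom_complete assms by blast
  have *: "\<And>u. u \<in> A \<Longrightarrow> \<Sqinter>\<^bsub>hom_lattice Q p q\<^esub> A \<preceq> u"
    using L.inf_lower[of A] assms by (simp add: hom_lattice_def)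
  have "(\<forall>u\<in>A. w \<preceq> u) \<Longrightarrow> w \<preceq> \<Sqinter>\<^bsub>hom_lattice Q p q\<^esub> A"
    using L.inf_greatest[of A w] assms by (simp add: hom_lattice_def Lower_def subset_iff)
  then show ?thesis using assms * Inf_Hom[OF assms(1-3)] ale_trans by blast
qed

text \<open>\<open>lres\<close> is a definite description, so existence must be shown. The witness
  is the join of all \<open>v\<close> with \<open>v \<bullet> u \<preceq> w\<close>; since
  composition with \<open>u\<close> preserves joins, it belongs to this set itself. Uniqueness is
  antisymmetry.\<close>

lemma lres:
  assumes u: "u \<in> Hom Q p q" and w: "w \<in> Hom Q p r"
  shows lres_Hom: "lres Q w u \<in> Hom Q q r"
    and le_lres_iff: "v \<in> Hom Q q r \<Longrightarrow> v \<preceq> lres Q w u \<longleftrightarrow> v \<bullet> u \<preceq> w"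
proof -
  have obs: "p \<in> obs Q" "q \<in> obs Q" "r \<in> obs Q" using u w Hom_obs by auto
  have tgts: "tgt Q u = q" "tgt Q w = r" using u w by (auto simp: Hom_def)
  define A where "A = {v \<in> Hom Q q r. v \<bullet> u \<preceq> w}"
  define s where "s = \<Squnion>\<^bsub>hom_lattice Q q r\<^esub> A"
  have A: "A \<subseteq> Hom Q q r" by (auto simp: A_def)
  have s: "s \<in> Hom Q q r" unfolding s_def using Sup_Hom obs A by blast
  have "s \<bullet> u = \<Squnion>\<^bsub>hom_lattice Q p r\<^esub> ((\<lambda>v. v \<bullet> u) ` A)"
    unfolding s_def using cmp_Sup_left obs u A by blast
  moreover have "(\<lambda>v. v \<bullet> u) ` A \<subseteq> Hom Q p r" using u A cmp_Hom by blast
  ultimately have su: "s \<bullet> u \<preceq> w" using Sup_le_iff obs w by (auto simp: A_def)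
  have iff: "v \<bullet> u \<preceq> w \<longleftrightarrow> v \<preceq> s" if v: "v \<in> Hom Q q r" for v
  proof
    assume "v \<bullet> u \<preceq> w"
    then have "v \<in> A" using v A_def by blast
    then show "v \<preceq> s" using Sup_le_iff[OF obs(2,3) A s] ale_refl[OF s] s_def by simp
  next
    assume "v \<preceq> s"
    then have "v \<bullet> u \<preceq> s \<bullet> u" using cmp_mono_left u v s by blast
    then show "v \<bullet> u \<preceq> w" using su ale_trans cmp_Hom u v s w by blast
  qed
  have "lres Q w u = s"
    unfolding lres_def tgts
  proof (rule the_equality)
    fix z assume "z \<in> Hom Q q r \<and> (\<forall>v\<in>Hom Q q r. v \<bullet> u \<preceq> w \<longleftrightarrow> v \<preceq> z)"
    then show "z = s" using iff s ale_antisym ale_refl by metis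
  qed (use iff s in auto)
  then show "lres Q w u \<in> Hom Q q r" "v \<in> Hom Q q r \<Longrightarrow> v \<preceq> lres Q w u \<longleftrightarrow> v \<bullet> u \<preceq> w"
    using s iff by auto
qed

end

section \<open>Categories and functors over a quantaloid\<close>

lemma qcategoryD:
  assumes "qcategory Q X"
  shows "x \<in> pts X \<Longrightarrow> tp X x \<in> obs Q"
    and "x \<in> pts X \<Longrightarrow> y \<in> pts X \<Longrightarrow> hm X x y \<in> Hom Q (tp X x) (tp X y)"
    and "x \<in> pts X \<Longrightarrow> idn Q (tp X x) \<preceq>\<^bsub>Q\<^esub> hm X x x"
    and "x \<in> pts X \<Longrightarrow> y \<in> pts X \<Longrightarrow> z \<in> pts X \<Longrightarrow> hm X y z \<bullet>\<^bsub>Q\<^esub> hm X x y \<preceq>\<^bsub>Q\<^esub> hm X x z"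
  using assms by (auto simp: qcategory_def)

lemma qfunctorD:
  assumes "qfunctor Q X Y f"
  shows "f \<in> extensional (pts X)"
    and "x \<in> pts X \<Longrightarrow> f x \<in> pts Y"
    and "x \<in> pts X \<Longrightarrow> tp Y (f x) = tp X x"
    and "x \<in> pts X \<Longrightarrow> y \<in> pts X \<Longrightarrow> hm X x y \<preceq>\<^bsub>Q\<^esub> hm Y (f x) (f y)"
  using assms by (auto simp: qfunctor_def PiE_def)

lemma distributorD:
  assumes "distributor Q X Y \<phi>" "x \<in> pts X" "y \<in> pts Y"
  shows "\<phi> x y \<in> Hom Q (tp X x) (tp Y y)"
    and "x' \<in> pts X \<Longrightarrow> y' \<in> pts Y \<Longrightarrow> hm Y y y' \<bullet>\<^bsub>Q\<^esub> \<phi> x y \<bullet>\<^bsub>Q\<^esub> hm X x' x \<preceq>\<^bsub>Q\<^esub> \<phi> x' y'"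
  using assms by (auto simp: distributor_def)

context quantaloid
begin

lemma le_hm_refl_cmp:
  assumes "qcategory Q X" "x \<in> pts X" "u \<in> Hom Q (tp X x) q"
  shows "u \<preceq> u \<bullet> hm X x x"
  using cmp_mono_right[OF _ _ assms(3), of "idn Q (tp X x)" "tp X x" "hm X x x"]
    qcategoryD[OF assms(1)] assms(2,3) idn_Hom cmp_idn_right by metis

lemma le_cmp_hm_refl:
  assumes "qcategory Q X" "x \<in> pts X" "u \<in> Hom Q p (tp X x)"
  shows "u \<preceq> hm X x x \<bullet> u"
  using cmp_mono_left[OF assms(3), of "idn Q (tp X x)" "tp X x" "hm X x x"]
    qcategoryD[OF assms(1)] assms(2,3) idn_Hom cmp_idn_left by metis

text \<open>The two-sided law is used with Y(y, y) on the left; this extra factor can be inserted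
  because it lies above the identity.\<close>

lemma distributor_right:
  assumes X: "qcategory Q X" and Y: "qcategory Q Y" and \<phi>: "distributor Q X Y \<phi>"
    and x: "x \<in> pts X" "x' \<in> pts X" and y: "y \<in> pts Y"
  shows "\<phi> x y \<bullet> hm X x' x \<preceq> \<phi> x' y"
proof -
  note a = distributorD(1)[OF \<phi> x(1) y] and a' = distributorD(1)[OF \<phi> x(2) y]
    and h = qcategoryD(2)[OF X x(2,1)] and k = qcategoryD(2)[OF Y y y]
  have "\<phi> x y \<bullet> hm X x' x \<preceq> hm Y y y \<bullet> \<phi> x y \<bullet> hm X x' x"
    by (rule cmp_mono_left[OF h a cmp_Hom[OF a k] le_cmp_hm_refl[OF Y y a]])
  then show ?thesis
    by (rule ale_trans[OF cmp_Hom[OF h a] cmp_Hom[OF h cmp_Hom[OF a k]] a'])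
      (rule distributorD(2)[OF \<phi> x(1) y x(2) y])
qed

lemma distributor_left:
  assumes X: "qcategory Q X" and Y: "qcategory Q Y" and \<phi>: "distributor Q X Y \<phi>"
    and x: "x \<in> pts X" and y: "y \<in> pts Y" "y' \<in> pts Y"
  shows "hm Y y y' \<bullet> \<phi> x y \<preceq> \<phi> x y'"
proof -
  note a = cmp_Hom[OF distributorD(1)[OF \<phi> x y(1)] qcategoryD(2)[OF Y y]]
    and a' = distributorD(1)[OF \<phi> x y(2)] and h = qcategoryD(2)[OF X x x]
  show ?thesis
    by (rule ale_trans[OF a cmp_Hom[OF h a] a' le_hm_refl_cmp[OF X x a]])
      (rule distributorD(2)[OF \<phi> x y(1) x y(2)])
qed

text \<open>Acting first on the left and then on the right recovers the two-sided law, so the two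
  actions can be checked separately.\<close>

lemma distributorI:
  assumes X: "qcategory Q X" and Y: "qcategory Q Y"
    and ext: "\<phi> \<in> extensional2 (pts X) (pts Y)"
    and H: "\<And>x y. x \<in> pts X \<Longrightarrow> y \<in> pts Y \<Longrightarrow> \<phi> x y \<in> Hom Q (tp X x) (tp Y y)"
    and R: "\<And>x x' y. x \<in> pts X \<Longrightarrow> x' \<in> pts X \<Longrightarrow> y \<in> pts Y \<Longrightarrow> \<phi> x y \<bullet> hm X x' x \<preceq> \<phi> x' y"
    and L: "\<And>x y y'. x \<in> pts X \<Longrightarrow> y \<in> pts Y \<Longrightarrow> y' \<in> pts Y \<Longrightarrow> hm Y y y' \<bullet> \<phi> x y \<preceq> \<phi> x y'"
  shows "distributor Q X Y \<phi>"
  unfolding distributor_def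
proof (intro conjI ballI ext H)
  fix x x' y y' assume *: "x \<in> pts X" "x' \<in> pts X" "y \<in> pts Y" "y' \<in> pts Y"
  note h = qcategoryD(2)[OF X *(2,1)] and k = qcategoryD(2)[OF Y *(3,4)]
    and a = H[OF *(1,3)] and b = H[OF *(1,4)]
  show "hm Y y y' \<bullet> \<phi> x y \<bullet> hm X x' x \<preceq> \<phi> x' y'"
    by (rule ale_trans[OF cmp_Hom[OF h cmp_Hom[OF a k]] cmp_Hom[OF h b] H[OF *(2,4)]
        cmp_mono_left[OF h cmp_Hom[OF a k] b L[OF *(1,3,4)]] R[OF *(1,2,4)]])
qed

section \<open>The underlying preorder and its compatibility with functors\<close>

text \<open>Reflexivity is exactly the unit law of the category.\<close>

lemma qle_refl: "qcategory Q X \<Longrightarrow> x \<in> pts X \<Longrightarrow> qle Q X x x"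
  by (simp add: qle_def qcategoryD)

lemma qle_trans:
  assumes X: "qcategory Q X" and pts: "x \<in> pts X" "y \<in> pts X" "z \<in> pts X"
    and le: "qle Q X x y" "qle Q X y z"
  shows "qle Q X x z"
proof -
  let ?p = "tp X x"
  have t: "tp X y = ?p" "tp X z = ?p" using le by (auto simp: qle_def)
  have H: "idn Q ?p \<in> Hom Q ?p ?p" "hm X x y \<in> Hom Q ?p ?p" "hm X y z \<in> Hom Q ?p ?p"
    "hm X x z \<in> Hom Q ?p ?p"
    using qcategoryD[OF X] pts t idn_Hom by metis+
  have "idn Q ?p \<bullet> idn Q ?p \<preceq> hm X y z \<bullet> hm X x y"
    using cmp_mono[OF H(1,2,1,3)] le t by (simp add: qle_def)
  then have "idn Q ?p \<preceq> hm X y z \<bullet> hm X x y" using cmp_idn_left H(1) by simp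
  then have "idn Q ?p \<preceq> hm X x z"
    using qcategoryD(4)[OF X pts] ale_trans H cmp_Hom by meson
  then show ?thesis using t by (simp add: qle_def)
qed

lemma qfunctor_id: "qcategory Q X \<Longrightarrow> qfunctor Q X X (\<lambda>x\<in>pts X. x)"
  by (auto simp: qfunctor_def intro: ale_refl dest: qcategoryD(2))

lemma qfunctor_compose:
  assumes X: "qcategory Q X" and Y: "qcategory Q Y" and Z: "qcategory Q Z"
    and f: "qfunctor Q X Y f" and g: "qfunctor Q Y Z g"
  shows "qfunctor Q X Z (compose (pts X) g f)"
  unfolding qfunctor_def
proof (intro conjI ballI)
  fix x y assume *: "x \<in> pts X" "y \<in> pts X"
  note F = qfunctorD[OF f] and G = qfunctorD[OF g]
  have "hm X x y \<in> Hom Q (tp X x) (tp X y)" "hm Y (f x) (f y) \<in> Hom Q (tp X x) (tp X y)"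
    "hm Z (g (f x)) (g (f y)) \<in> Hom Q (tp X x) (tp X y)"
    using qcategoryD(2)[OF X] qcategoryD(2)[OF Y] qcategoryD(2)[OF Z] F(2,3) G(2,3) * by metis+
  moreover have "hm X x y \<preceq> hm Y (f x) (f y)" "hm Y (f x) (f y) \<preceq> hm Z (g (f x)) (g (f y))"
    using F G * by blast+
  ultimately have "hm X x y \<preceq> hm Z (g (f x)) (g (f y))" using ale_trans by blast
  then show "hm X x y \<preceq> hm Z (compose (pts X) g f x) (compose (pts X) g f y)"
    using * by (simp add: compose_def)
qed (use qfunctorD[OF f] qfunctorD[OF g] in \<open>auto simp: compose_def\<close>)

lemma qfunctor_qle:
  assumes X: "qcategory Q X" and Y: "qcategory Q Y" and f: "qfunctor Q X Y f"
    and x: "x \<in> pts X" "y \<in> pts X" and le: "qle Q X x y"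
  shows "qle Q Y (f x) (f y)"
proof -
  note F = qfunctorD[OF f]
  have t: "tp X y = tp X x" using le by (simp add: qle_def)
  have "idn Q (tp X x) \<preceq> hm X x y" using le unfolding qle_def by blast
  moreover have "hm X x y \<in> Hom Q (tp X x) (tp X x)" using qcategoryD(2)[OF X x] t by simp
  moreover have "hm Y (f x) (f y) \<in> Hom Q (tp X x) (tp X x)"
    using qcategoryD(2)[OF Y F(2)[OF x(1)] F(2)[OF x(2)]] F(3) x t by simp
  ultimately have "idn Q (tp X x) \<preceq> hm Y (f x) (f y)"
    using F(4)[OF x] ale_trans idn_Hom qcategoryD(1)[OF X x(1)] by meson
  then show ?thesis using t F(3) x by (simp add: qle_def)
qed

lemma qfun_le_refl: "qcategory Q Y \<Longrightarrow> qfunctor Q X Y f \<Longrightarrow> qfun_le Q X Y f f"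
  by (simp add: qfun_le_def qfunctorD qle_refl)

lemma qfun_le_trans:
  assumes "qcategory Q Y" "qfunctor Q X Y f" "qfunctor Q X Y g" "qfunctor Q X Y h"
    "qfun_le Q X Y f g" "qfun_le Q X Y g h"
  shows "qfun_le Q X Y f h"
  unfolding qfun_le_def
proof
  fix x assume x: "x \<in> pts X"
  show "qle Q Y (f x) (h x)"
    by (rule qle_trans[OF assms(1), of _ "g x"])
      (use assms x in \<open>auto simp: qfun_le_def dest: qfunctorD(2)\<close>)
qed

text \<open>The comparison passes through g f': functoriality of g gives g f \<le> g f', and g \<le>
  g' is then evaluated at f' x.\<close>

lemma qfun_le_compose:
  assumes X: "qcategory Q X" and Y: "qcategory Q Y" and Z: "qcategory Q Z"
    and f: "qfunctor Q X Y f" "qfunctor Q X Y f'" and g: "qfunctor Q Y Z g" "qfunctor Q Y Z g'"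
    and le: "qfun_le Q X Y f f'" "qfun_le Q Y Z g g'"
  shows "qfun_le Q X Z (compose (pts X) g f) (compose (pts X) g' f')"
  unfolding qfun_le_def
proof
  fix x assume x: "x \<in> pts X"
  note F = qfunctorD(2)[OF f(1) x] qfunctorD(2)[OF f(2) x]
  have "qle Q Z (g (f x)) (g (f' x))"
    using qfunctor_qle[OF Y Z g(1) F] le(1) x by (simp add: qfun_le_def)
  moreover have "qle Q Z (g (f' x)) (g' (f' x))" using le(2) F by (simp add: qfun_le_def)
  ultimately have "qle Q Z (g (f x)) (g' (f' x))"
    by (rule qle_trans[OF Z qfunctorD(2)[OF g(1) F(1)] qfunctorD(2)[OF g(1) F(2)]
        qfunctorD(2)[OF g(2) F(2)]])
  then show "qle Q Z (compose (pts X) g f x) (compose (pts X) g' f' x)"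
    using x by (simp add: compose_def)
qed

end

section \<open>Presheaves and Kan adjunctions\<close>

lemma one_qcat_simps [simp]:
  "pts (one_qcat Q q) = {()}" "tp (one_qcat Q q) x = q" "hm (one_qcat Q q) x y = idn Q q"
  by (simp_all add: one_qcat_def)

lemma extensional2_restrict2 [simp]: "restrict2 f A B \<in> extensional2 A B"
  by (auto simp: extensional2_def restrict2_def)

lemma restrict2_apply [simp]: "x \<in> A \<Longrightarrow> y \<in> B \<Longrightarrow> restrict2 f A B x y = f x y"
  by (simp add: restrict2_def)

lemma extensional2_eqI:
  assumes "f \<in> extensional2 A B" "g \<in> extensional2 A B"
    and "\<And>x y. x \<in> A \<Longrightarrow> y \<in> B \<Longrightarrow> f x y = g x y"
  shows "f = g"
proof (intro ext)
  fix x y show "f x y = g x y"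
    using assms by (cases "x \<in> A \<and> y \<in> B") (auto simp: extensional2_def)
qed

lemma pts_PSh: "pts (PSh Q X) = {(q, \<mu>). q \<in> obs Q \<and> distributor Q X (one_qcat Q q) \<mu>}"
  by (simp add: PSh_def Let_def)

lemma tp_PSh [simp]: "\<mu> \<in> pts (PSh Q X) \<Longrightarrow> tp (PSh Q X) \<mu> = fst \<mu>"
  by (simp add: PSh_def Let_def)

lemma PSh_eqI:
  assumes "\<mu> \<in> pts (PSh Q X)" "\<nu> \<in> pts (PSh Q X)" "fst \<mu> = fst \<nu>"
    and "\<And>x. x \<in> pts X \<Longrightarrow> pval \<mu> x = pval \<nu> x"
  shows "\<mu> = \<nu>"
proof (rule prod_eqI)
  show "snd \<mu> = snd \<nu>"
    by (rule extensional2_eqI[of _ "pts X" "{()}"])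
      (use assms in \<open>auto simp: pts_PSh distributor_def pval_def\<close>)
qed (rule assms)

context quantaloid
begin

lemma Sup_cmp_le_iff:
  assumes u: "u \<in> Hom Q p q" and A: "A \<subseteq> Hom Q q r" and w: "w \<in> Hom Q p r" and r: "r \<in> obs Q"
  shows "(\<Squnion>\<^bsub>hom_lattice Q q r\<^esub> A) \<bullet> u \<preceq> w \<longleftrightarrow> (\<forall>v\<in>A. v \<bullet> u \<preceq> w)"
proof -
  have o: "p \<in> obs Q" "q \<in> obs Q" using u Hom_obs by auto
  have "(\<lambda>v. v \<bullet> u) ` A \<subseteq> Hom Q p r" using A u cmp_Hom by blast
  then show ?thesis using cmp_Sup_left[OF o r u A] Sup_le_iff[OF o(1) r _ w] by simp
qed

lemma cmp_Sup_le_iff: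
  assumes v: "v \<in> Hom Q q r" and A: "A \<subseteq> Hom Q p q" and w: "w \<in> Hom Q p r" and p: "p \<in> obs Q"
  shows "v \<bullet> (\<Squnion>\<^bsub>hom_lattice Q p q\<^esub> A) \<preceq> w \<longleftrightarrow> (\<forall>u\<in>A. v \<bullet> u \<preceq> w)"
proof -
  have o: "q \<in> obs Q" "r \<in> obs Q" using v Hom_obs by auto
  have "(\<lambda>u. v \<bullet> u) ` A \<subseteq> Hom Q p r" using A v cmp_Hom by blast
  then show ?thesis using cmp_Sup_right[OF p o v A] Sup_le_iff[OF p o(2) _ w] by simp
qed

text \<open>The meet of residuals becomes one quantified inequality. Only the entries in the chosen
  row and column are assumed well typed, so the fact serves both the homs of P X and
  \<open>kan_low\<close>.\<close>

lemma dist_lres: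
  assumes y: "y \<in> pts Y" "tp Y y \<in> obs Q" and z: "z \<in> pts Z" "tp Z z \<in> obs Q"
    and \<phi>: "\<And>x. x \<in> pts X \<Longrightarrow> \<phi> x y \<in> Hom Q (tp X x) (tp Y y)"
    and \<xi>: "\<And>x. x \<in> pts X \<Longrightarrow> \<xi> x z \<in> Hom Q (tp X x) (tp Z z)"
  shows dist_lres_Hom: "dist_lres Q X Y Z \<xi> \<phi> y z \<in> Hom Q (tp Y y) (tp Z z)"
    and le_dist_lres_iff: "v \<in> Hom Q (tp Y y) (tp Z z) \<Longrightarrow>
      v \<preceq> dist_lres Q X Y Z \<xi> \<phi> y z \<longleftrightarrow> (\<forall>x\<in>pts X. v \<bullet> \<phi> x y \<preceq> \<xi> x z)"
proof -
  let ?A = "(\<lambda>x. lres Q (\<xi> x z) (\<phi> x y)) ` pts X"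
  have eq: "dist_lres Q X Y Z \<xi> \<phi> y z = \<Sqinter>\<^bsub>hom_lattice Q (tp Y y) (tp Z z)\<^esub> ?A"
    using y z by (simp add: dist_lres_def)
  have A: "?A \<subseteq> Hom Q (tp Y y) (tp Z z)" using lres_Hom \<phi> \<xi> by blast
  show "dist_lres Q X Y Z \<xi> \<phi> y z \<in> Hom Q (tp Y y) (tp Z z)"
    unfolding eq using Inf_Hom y z A by blast
  assume v: "v \<in> Hom Q (tp Y y) (tp Z z)"
  show "v \<preceq> dist_lres Q X Y Z \<xi> \<phi> y z \<longleftrightarrow> (\<forall>x\<in>pts X. v \<bullet> \<phi> x y \<preceq> \<xi> x z)"
    unfolding eq using le_Inf_iff[OF y(2) z(2) A v] le_lres_iff[OF \<phi> \<xi> v] by simp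
qed

lemma qcategory_one: "q \<in> obs Q \<Longrightarrow> qcategory Q (one_qcat Q q)"
  using idn_Hom ale_refl[OF idn_Hom] cmp_idn_left[OF idn_Hom]
  by (auto simp: qcategory_def extensional2_def one_qcat_def)

lemma PShD:
  assumes X: "qcategory Q X" and \<mu>: "\<mu> \<in> pts (PSh Q X)"
  shows "fst \<mu> \<in> obs Q"
    and "x \<in> pts X \<Longrightarrow> pval \<mu> x \<in> Hom Q (tp X x) (fst \<mu>)"
    and "x \<in> pts X \<Longrightarrow> x' \<in> pts X \<Longrightarrow> pval \<mu> x \<bullet> hm X x' x \<preceq> pval \<mu> x'"
proof -
  have q: "fst \<mu> \<in> obs Q" and d: "distributor Q X (one_qcat Q (fst \<mu>)) (snd \<mu>)"
    using \<mu> by (auto simp: pts_PSh)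
  show "fst \<mu> \<in> obs Q" by (rule q)
  show "x \<in> pts X \<Longrightarrow> pval \<mu> x \<in> Hom Q (tp X x) (fst \<mu>)"
    using distributorD(1)[OF d, of x "()"] by (simp add: pval_def)
  show "x \<in> pts X \<Longrightarrow> x' \<in> pts X \<Longrightarrow> pval \<mu> x \<bullet> hm X x' x \<preceq> pval \<mu> x'"
    using distributor_right[OF X qcategory_one[OF q] d, of x x' "()"] by (simp add: pval_def)
qed

text \<open>The left action on a distributor into \<open>one_qcat\<close> is composition with an
  identity, which leaves only the right action to check.\<close>

lemma PShI:
  assumes X: "qcategory Q X" and q: "q \<in> obs Q" and ext: "m \<in> extensional2 (pts X) {()}"
    and H: "\<And>x. x \<in> pts X \<Longrightarrow> m x () \<in> Hom Q (tp X x) q"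
    and R: "\<And>x x'. x \<in> pts X \<Longrightarrow> x' \<in> pts X \<Longrightarrow> m x () \<bullet> hm X x' x \<preceq> m x' ()"
  shows "(q, m) \<in> pts (PSh Q X)"
proof -
  have "distributor Q X (one_qcat Q q) m"
    by (rule distributorI[OF X qcategory_one[OF q]])
      (use ext H R cmp_idn_left[OF H] ale_refl[OF H] in auto)
  then show ?thesis using q by (simp add: pts_PSh)
qed

lemma hm_PSh:
  assumes X: "qcategory Q X" and \<mu>: "\<mu> \<in> pts (PSh Q X)" and \<nu>: "\<nu> \<in> pts (PSh Q X)"
  shows hm_PSh_Hom: "hm (PSh Q X) \<mu> \<nu> \<in> Hom Q (fst \<mu>) (fst \<nu>)"
    and le_hm_PSh_iff: "v \<in> Hom Q (fst \<mu>) (fst \<nu>) \<Longrightarrow>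
      v \<preceq> hm (PSh Q X) \<mu> \<nu> \<longleftrightarrow> (\<forall>x\<in>pts X. v \<bullet> pval \<mu> x \<preceq> pval \<nu> x)"
proof -
  have eq: "hm (PSh Q X) \<mu> \<nu> =
      dist_lres Q X (one_qcat Q (fst \<mu>)) (one_qcat Q (fst \<nu>)) (snd \<nu>) (snd \<mu>) () ()"
    using \<mu> \<nu> by (auto simp: PSh_def Let_def)
  note M = PShD[OF X \<mu>] and N = PShD[OF X \<nu>]
  show "hm (PSh Q X) \<mu> \<nu> \<in> Hom Q (fst \<mu>) (fst \<nu>)"
    using dist_lres_Hom[of "()" "one_qcat Q (fst \<mu>)" "()" "one_qcat Q (fst \<nu>)" X "snd \<mu>" "snd \<nu>"]
      M(1,2) N(1,2) by (simp add: eq pval_def)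
  show "v \<in> Hom Q (fst \<mu>) (fst \<nu>) \<Longrightarrow>
      v \<preceq> hm (PSh Q X) \<mu> \<nu> \<longleftrightarrow> (\<forall>x\<in>pts X. v \<bullet> pval \<mu> x \<preceq> pval \<nu> x)"
    using le_dist_lres_iff[of "()" "one_qcat Q (fst \<mu>)" "()" "one_qcat Q (fst \<nu>)" X "snd \<mu>" "snd \<nu>" v]
      M(1,2) N(1,2) by (simp add: eq pval_def)
qed

text \<open>The universal property of the hom, tested at the hom itself.\<close>

lemma hm_PSh_cmp_le:
  assumes "qcategory Q X" "\<mu> \<in> pts (PSh Q X)" "\<nu> \<in> pts (PSh Q X)" "x \<in> pts X"
  shows "hm (PSh Q X) \<mu> \<nu> \<bullet> pval \<mu> x \<preceq> pval \<nu> x"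
  using le_hm_PSh_iff[OF assms(1-3)] hm_PSh_Hom[OF assms(1-3)] ale_refl assms(4) by blast

lemma qcategory_PSh:
  assumes X: "qcategory Q X"
  shows "qcategory Q (PSh Q X)"
  unfolding qcategory_def
proof (intro conjI ballI)
  show "tp (PSh Q X) \<in> pts (PSh Q X) \<rightarrow>\<^sub>E obs Q"
    by (auto simp: PSh_def Let_def)
  show "hm (PSh Q X) \<in> extensional2 (pts (PSh Q X)) (pts (PSh Q X))"
    by (simp add: PSh_def Let_def)
next
  fix \<mu> \<nu> assume *: "\<mu> \<in> pts (PSh Q X)" "\<nu> \<in> pts (PSh Q X)"
  then show "hm (PSh Q X) \<mu> \<nu> \<in> Hom Q (tp (PSh Q X) \<mu>) (tp (PSh Q X) \<nu>)"
    using hm_PSh_Hom[OF X] by simp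
next
  fix \<mu> assume *: "\<mu> \<in> pts (PSh Q X)"
  note M = PShD[OF X *]
  show "idn Q (tp (PSh Q X) \<mu>) \<preceq> hm (PSh Q X) \<mu> \<mu>"
    using * le_hm_PSh_iff[OF X * * idn_Hom[OF M(1)]] cmp_idn_left[OF M(2)] ale_refl[OF M(2)]
    by simp
next
  fix \<rho> \<mu> \<nu> assume *: "\<rho> \<in> pts (PSh Q X)" "\<mu> \<in> pts (PSh Q X)" "\<nu> \<in> pts (PSh Q X)"
  note h = hm_PSh_Hom[OF X *(1,2)] and k = hm_PSh_Hom[OF X *(2,3)]
  \<comment> \<open>A composite of homs lies below a hom once it does so after composition with each
    value of \<rho>; there it is absorbed by two evaluations, from \<rho> to \<mu> and from \<mu> to
    \<nu>.\<close>
  have "(hm (PSh Q X) \<mu> \<nu> \<bullet> hm (PSh Q X) \<rho> \<mu>) \<bullet> pval \<rho> x \<preceq> pval \<nu> x" if x: "x \<in> pts X" for x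
  proof -
    note l = PShD(2)[OF X *(1) x] and m = PShD(2)[OF X *(2) x] and n = PShD(2)[OF X *(3) x]
    show ?thesis
      unfolding cmp_assoc[OF l h k, symmetric]
      by (rule ale_trans[OF cmp_Hom[OF cmp_Hom[OF l h] k] cmp_Hom[OF m k] n
          cmp_mono_right[OF cmp_Hom[OF l h] m k hm_PSh_cmp_le[OF X *(1,2) x]]
          hm_PSh_cmp_le[OF X *(2,3) x]])
  qed
  then show "hm (PSh Q X) \<mu> \<nu> \<bullet> hm (PSh Q X) \<rho> \<mu> \<preceq> hm (PSh Q X) \<rho> \<nu>"
    using le_hm_PSh_iff[OF X *(1,3) cmp_Hom[OF h k]] by blast
qed

text \<open>This is the universal property of the hom at the identity arrow.\<close>

lemma qle_PSh_iff:
  assumes X: "qcategory Q X" and \<mu>: "\<mu> \<in> pts (PSh Q X)" and \<nu>: "\<nu> \<in> pts (PSh Q X)"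
  shows "qle Q (PSh Q X) \<mu> \<nu> \<longleftrightarrow>
    fst \<mu> = fst \<nu> \<and> (\<forall>x\<in>pts X. pval \<mu> x \<preceq> pval \<nu> x)"
proof (cases "fst \<mu> = fst \<nu>")
  case True
  note M = PShD[OF X \<mu>]
  have "idn Q (fst \<mu>) \<in> Hom Q (fst \<mu>) (fst \<nu>)" using idn_Hom[OF M(1)] True by simp
  then show ?thesis
    using True le_hm_PSh_iff[OF X \<mu> \<nu>] cmp_idn_left[OF M(2)] \<mu> \<nu> by (simp add: qle_def)
qed (use \<mu> \<nu> in \<open>simp add: qle_def\<close>)

text \<open>A category over a quantaloid need not be separated, but P X is. This turns the
  inequalities of the Kan adjunction into fixed-point equations.\<close>

lemma qle_PSh_antisym:
  assumes X: "qcategory Q X" and \<mu>: "\<mu> \<in> pts (PSh Q X)" and \<nu>: "\<nu> \<in> pts (PSh Q X)"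
    and le: "qle Q (PSh Q X) \<mu> \<nu>" "qle Q (PSh Q X) \<nu> \<mu>"
  shows "\<mu> = \<nu>"
proof (rule PSh_eqI[OF \<mu> \<nu>])
  show t: "fst \<mu> = fst \<nu>" using le \<mu> \<nu> by (simp add: qle_def)
  fix x assume x: "x \<in> pts X"
  show "pval \<mu> x = pval \<nu> x"
    using ale_antisym[OF PShD(2)[OF X \<mu> x], of "pval \<nu> x"] PShD(2)[OF X \<nu> x] le x t
      qle_PSh_iff[OF X \<mu> \<nu>] qle_PSh_iff[OF X \<nu> \<mu>] by simp
qed

end

section \<open>The Kan adjunction of a distributor\<close>

locale qdistributor = quantaloid Q
  for Q :: "('o, 'm) ocat" (structure) and X :: "('a, 'o, 'm) qcat" and Y :: "('b, 'o, 'm) qcat"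
    and \<phi> :: "'a \<Rightarrow> 'b \<Rightarrow> 'm" +
  assumes X: "qcategory Q X" and Y: "qcategory Q Y"
    and dist: "distributor Q X Y \<phi>"
begin

lemma fst_kan_up [simp]: "\<rho> \<in> pts (PSh Q Y) \<Longrightarrow> fst (kan_up Q X Y \<phi> \<rho>) = fst \<rho>"
  by (auto simp: kan_up_def case_prod_unfold)

lemma fst_kan_low [simp]: "\<mu> \<in> pts (PSh Q X) \<Longrightarrow> fst (kan_low Q X Y \<phi> \<mu>) = fst \<mu>"
  by (auto simp: kan_low_def case_prod_unfold)

lemma pval_kan_up:
  assumes "\<rho> \<in> pts (PSh Q Y)" "x \<in> pts X"
  shows "pval (kan_up Q X Y \<phi> \<rho>) x =
    \<Squnion>\<^bsub>hom_lattice Q (tp X x) (fst \<rho>)\<^esub> ((\<lambda>y. pval \<rho> y \<bullet> \<phi> x y) ` pts Y)"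
  using assms by (auto simp: kan_up_def case_prod_unfold pval_def dist_comp_def)

lemma kan_up_family:
  assumes "\<rho> \<in> pts (PSh Q Y)" "x \<in> pts X"
  shows "(\<lambda>y. pval \<rho> y \<bullet> \<phi> x y) ` pts Y \<subseteq> Hom Q (tp X x) (fst \<rho>)"
  using cmp_Hom[OF distributorD(1)[OF dist] PShD(2)[OF Y]] assms by blast

lemma pval_kan_up_Hom:
  assumes "\<rho> \<in> pts (PSh Q Y)" "x \<in> pts X"
  shows "pval (kan_up Q X Y \<phi> \<rho>) x \<in> Hom Q (tp X x) (fst \<rho>)"
  unfolding pval_kan_up[OF assms]
  by (rule Sup_Hom[OF qcategoryD(1)[OF X assms(2)] PShD(1)[OF Y assms(1)] kan_up_family[OF assms]])

text \<open>This and \<open>le_kan_low_iff\<close> are the two halves from which the adjunction is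
  derived: both sides of \<open>\<phi>\<^sup>* \<stileturn> \<phi>\<^sub>*\<close> reduce to
  inequalities involving the individual entries of \<phi>.\<close>

lemma kan_up_le_iff:
  assumes "\<rho> \<in> pts (PSh Q Y)" "x \<in> pts X" "w \<in> Hom Q (tp X x) (fst \<rho>)"
  shows "pval (kan_up Q X Y \<phi> \<rho>) x \<preceq> w \<longleftrightarrow> (\<forall>y\<in>pts Y. pval \<rho> y \<bullet> \<phi> x y \<preceq> w)"
  unfolding pval_kan_up[OF assms(1,2)]
  using Sup_le_iff[OF _ _ kan_up_family[OF assms(1,2)] assms(3)] Hom_obs[OF assms(3)] by simp

lemma le_kan_up:
  assumes "\<rho> \<in> pts (PSh Q Y)" "x \<in> pts X" "y \<in> pts Y"
  shows "pval \<rho> y \<bullet> \<phi> x y \<preceq> pval (kan_up Q X Y \<phi> \<rho>) x"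
  using kan_up_le_iff[OF assms(1,2) pval_kan_up_Hom[OF assms(1,2)]]
    ale_refl[OF pval_kan_up_Hom[OF assms(1,2)]] assms(3) by simp

lemma kan_up_PSh:
  assumes \<rho>: "\<rho> \<in> pts (PSh Q Y)"
  shows "kan_up Q X Y \<phi> \<rho> \<in> pts (PSh Q X)"
proof -
  let ?u = "kan_up Q X Y \<phi> \<rho>"
  have "(fst ?u, snd ?u) \<in> pts (PSh Q X)"
  proof (rule PShI[OF X])
    show "fst ?u \<in> obs Q" using PShD(1)[OF Y \<rho>] \<rho> by simp
    show "snd ?u \<in> extensional2 (pts X) {()}"
      using \<rho> by (auto simp: kan_up_def case_prod_unfold dist_comp_def)
    show "snd ?u x () \<in> Hom Q (tp X x) (fst ?u)" if "x \<in> pts X" for x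
      using pval_kan_up_Hom[OF \<rho> that] \<rho> by (simp add: pval_def)
    fix x x' assume x: "x \<in> pts X" "x' \<in> pts X"
    \<comment> \<open>Composition with X(x', x) distributes over the join, so the action law is
      checked on each term, where the factor is absorbed by \<phi>.\<close>
    have "pval \<rho> y \<bullet> \<phi> x y \<bullet> hm X x' x \<preceq> pval ?u x'" if y: "y \<in> pts Y" for y
    proof -
      note h = qcategoryD(2)[OF X x(2,1)] and a = distributorD(1)[OF dist x(1) y]
        and a' = distributorD(1)[OF dist x(2) y] and l = PShD(2)[OF Y \<rho> y]
      show ?thesis
        unfolding cmp_assoc[OF h a l, symmetric]
        by (rule ale_trans[OF cmp_Hom[OF cmp_Hom[OF h a] l] cmp_Hom[OF a' l]
            pval_kan_up_Hom[OF \<rho> x(2)]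
            cmp_mono_right[OF cmp_Hom[OF h a] a' l distributor_right[OF X Y dist x y]]
            le_kan_up[OF \<rho> x(2) y]])
    qed
    then have "pval ?u x \<bullet> hm X x' x \<preceq> pval ?u x'"
      unfolding pval_kan_up[OF \<rho> x(1)]
      using Sup_cmp_le_iff[OF qcategoryD(2)[OF X x(2,1)] kan_up_family[OF \<rho> x(1)]
          pval_kan_up_Hom[OF \<rho> x(2)] PShD(1)[OF Y \<rho>]] by simp
    then show "snd ?u x () \<bullet> hm X x' x \<preceq> snd ?u x' ()" by (simp add: pval_def)
  qed
  then show ?thesis by simp
qed

lemma pval_kan_low:
  assumes "\<mu> \<in> pts (PSh Q X)"
  shows "pval (kan_low Q X Y \<phi> \<mu>) y = dist_lres Q X Y (one_qcat Q (fst \<mu>)) (snd \<mu>) \<phi> y ()"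
  using assms by (auto simp: kan_low_def case_prod_unfold pval_def)

lemma pval_kan_low_Hom:
  assumes "\<mu> \<in> pts (PSh Q X)" "y \<in> pts Y"
  shows "pval (kan_low Q X Y \<phi> \<mu>) y \<in> Hom Q (tp Y y) (fst \<mu>)"
  using dist_lres_Hom[OF assms(2), of "()" "one_qcat Q (fst \<mu>)" X \<phi> "snd \<mu>"] PShD(1,2)[OF X assms(1)]
    qcategoryD(1)[OF Y assms(2)] distributorD(1)[OF dist _ assms(2)]
  by (simp add: pval_kan_low assms(1) flip: pval_def)

lemma le_kan_low_iff:
  assumes "\<mu> \<in> pts (PSh Q X)" "y \<in> pts Y" "v \<in> Hom Q (tp Y y) (fst \<mu>)"
  shows "v \<preceq> pval (kan_low Q X Y \<phi> \<mu>) y \<longleftrightarrow> (\<forall>x\<in>pts X. v \<bullet> \<phi> x y \<preceq> pval \<mu> x)"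
  using le_dist_lres_iff[OF assms(2), of "()" "one_qcat Q (fst \<mu>)" X \<phi> "snd \<mu>" v]
    PShD(1,2)[OF X assms(1)] assms(3)
    qcategoryD(1)[OF Y assms(2)] distributorD(1)[OF dist _ assms(2)]
  by (simp add: pval_kan_low assms(1) flip: pval_def)

lemma kan_low_cmp_le:
  assumes "\<mu> \<in> pts (PSh Q X)" "y \<in> pts Y" "x \<in> pts X"
  shows "pval (kan_low Q X Y \<phi> \<mu>) y \<bullet> \<phi> x y \<preceq> pval \<mu> x"
  using le_kan_low_iff[OF assms(1,2) pval_kan_low_Hom[OF assms(1,2)]]
    ale_refl[OF pval_kan_low_Hom[OF assms(1,2)]] assms(3) by simp

lemma kan_low_PSh:
  assumes \<mu>: "\<mu> \<in> pts (PSh Q X)"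
  shows "kan_low Q X Y \<phi> \<mu> \<in> pts (PSh Q Y)"
proof -
  let ?l = "kan_low Q X Y \<phi> \<mu>"
  have "(fst ?l, snd ?l) \<in> pts (PSh Q Y)"
  proof (rule PShI[OF Y])
    show "fst ?l \<in> obs Q" using PShD(1)[OF X \<mu>] \<mu> by simp
    show "snd ?l \<in> extensional2 (pts Y) {()}"
      using \<mu> by (auto simp: kan_low_def case_prod_unfold dist_lres_def)
    show "snd ?l y () \<in> Hom Q (tp Y y) (fst ?l)" if "y \<in> pts Y" for y
      using pval_kan_low_Hom[OF \<mu> that] \<mu> by (simp add: pval_def)
    fix y y' assume y: "y \<in> pts Y" "y' \<in> pts Y"
    note h = qcategoryD(2)[OF Y y(2,1)] and l = pval_kan_low_Hom[OF \<mu> y(1)]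
    \<comment> \<open>Testing against \<phi>(x, y') allows Y(y', y) to be absorbed into \<phi>(x, y)
      by the left action; what remains is the defining inequality of \<open>kan_low\<close> at
      y.\<close>
    have "(pval ?l y \<bullet> hm Y y' y) \<bullet> \<phi> x y' \<preceq> pval \<mu> x" if x: "x \<in> pts X" for x
    proof -
      note a = distributorD(1)[OF dist x y(1)] and a' = distributorD(1)[OF dist x y(2)]
      show ?thesis
        unfolding cmp_assoc[OF a' h l, symmetric]
        by (rule ale_trans[OF cmp_Hom[OF cmp_Hom[OF a' h] l] cmp_Hom[OF a l] PShD(2)[OF X \<mu> x]
            cmp_mono_right[OF cmp_Hom[OF a' h] a l distributor_left[OF X Y dist x y(2,1)]]
            kan_low_cmp_le[OF \<mu> y(1) x]])
    qed
    then have "pval ?l y \<bullet> hm Y y' y \<preceq> pval ?l y'"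
      using le_kan_low_iff[OF \<mu> y(2) cmp_Hom[OF h l]] by simp
    then show "snd ?l y () \<bullet> hm Y y' y \<preceq> snd ?l y' ()" by (simp add: pval_def)
  qed
  then show ?thesis by simp
qed

lemma qfunctor_kan_up: "qfunctor Q (PSh Q Y) (PSh Q X) (kan_up Q X Y \<phi>)"
  unfolding qfunctor_def
proof (intro conjI ballI)
  show "kan_up Q X Y \<phi> \<in> pts (PSh Q Y) \<rightarrow>\<^sub>E pts (PSh Q X)"
    using kan_up_PSh by (auto simp: kan_up_def case_prod_unfold)
  show "tp (PSh Q X) (kan_up Q X Y \<phi> \<rho>) = tp (PSh Q Y) \<rho>" if "\<rho> \<in> pts (PSh Q Y)" for \<rho>
    using that kan_up_PSh by simp
next
  fix \<rho> \<rho>' assume *: "\<rho> \<in> pts (PSh Q Y)" "\<rho>' \<in> pts (PSh Q Y)"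
  let ?h = "hm (PSh Q Y) \<rho> \<rho>'"
  note h = hm_PSh_Hom[OF Y *]
  have "?h \<bullet> pval (kan_up Q X Y \<phi> \<rho>) x \<preceq> pval (kan_up Q X Y \<phi> \<rho>') x" if x: "x \<in> pts X" for x
  proof -
    have "?h \<bullet> (pval \<rho> y \<bullet> \<phi> x y) \<preceq> pval (kan_up Q X Y \<phi> \<rho>') x" if y: "y \<in> pts Y" for y
    proof -
      note a = distributorD(1)[OF dist x y] and l = PShD(2)[OF Y *(1) y]
        and l' = PShD(2)[OF Y *(2) y]
      show ?thesis
        unfolding cmp_assoc[OF a l h]
        by (rule ale_trans[OF cmp_Hom[OF a cmp_Hom[OF l h]] cmp_Hom[OF a l']
            pval_kan_up_Hom[OF *(2) x]
            cmp_mono_left[OF a cmp_Hom[OF l h] l' hm_PSh_cmp_le[OF Y * y]]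
            le_kan_up[OF *(2) x y]])
    qed
    then show ?thesis
      unfolding pval_kan_up[OF *(1) x]
      using cmp_Sup_le_iff[OF h kan_up_family[OF *(1) x] pval_kan_up_Hom[OF *(2) x]]
        qcategoryD(1)[OF X x] by simp
  qed
  then show "?h \<preceq> hm (PSh Q X) (kan_up Q X Y \<phi> \<rho>) (kan_up Q X Y \<phi> \<rho>')"
    using le_hm_PSh_iff[OF X kan_up_PSh[OF *(1)] kan_up_PSh[OF *(2)]] h * by simp
qed

lemma qfunctor_kan_low: "qfunctor Q (PSh Q X) (PSh Q Y) (kan_low Q X Y \<phi>)"
  unfolding qfunctor_def
proof (intro conjI ballI)
  show "kan_low Q X Y \<phi> \<in> pts (PSh Q X) \<rightarrow>\<^sub>E pts (PSh Q Y)"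
    using kan_low_PSh by (auto simp: kan_low_def case_prod_unfold)
  show "tp (PSh Q Y) (kan_low Q X Y \<phi> \<mu>) = tp (PSh Q X) \<mu>" if "\<mu> \<in> pts (PSh Q X)" for \<mu>
    using that kan_low_PSh by simp
next
  fix \<mu> \<mu>' assume *: "\<mu> \<in> pts (PSh Q X)" "\<mu>' \<in> pts (PSh Q X)"
  let ?h = "hm (PSh Q X) \<mu> \<mu>'"
  note h = hm_PSh_Hom[OF X *]
  have "?h \<bullet> pval (kan_low Q X Y \<phi> \<mu>) y \<preceq> pval (kan_low Q X Y \<phi> \<mu>') y" if y: "y \<in> pts Y" for y
  proof -
    note l = pval_kan_low_Hom[OF *(1) y]
    have "(?h \<bullet> pval (kan_low Q X Y \<phi> \<mu>) y) \<bullet> \<phi> x y \<preceq> pval \<mu>' x" if x: "x \<in> pts X" for x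
    proof -
      note a = distributorD(1)[OF dist x y] and m = PShD(2)[OF X *(1) x]
        and m' = PShD(2)[OF X *(2) x]
      show ?thesis
        unfolding cmp_assoc[OF a l h, symmetric]
        by (rule ale_trans[OF cmp_Hom[OF cmp_Hom[OF a l] h] cmp_Hom[OF m h] m'
            cmp_mono_right[OF cmp_Hom[OF a l] m h kan_low_cmp_le[OF *(1) y x]]
            hm_PSh_cmp_le[OF X * x]])
    qed
    then show ?thesis using le_kan_low_iff[OF *(2) y cmp_Hom[OF l h]] by simp
  qed
  then show "?h \<preceq> hm (PSh Q Y) (kan_low Q X Y \<phi> \<mu>) (kan_low Q X Y \<phi> \<mu>')"
    using le_hm_PSh_iff[OF Y kan_low_PSh[OF *(1)] kan_low_PSh[OF *(2)]] h * by simp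
qed

text \<open>By the universal property of \<open>kan_low\<close>, this says that each term \<rho>(y)
  \<circ> \<phi>(x, y) lies below the join that defines \<open>kan_up\<close>.\<close>

lemma kan_unit:
  assumes \<rho>: "\<rho> \<in> pts (PSh Q Y)"
  shows "qle Q (PSh Q Y) \<rho> (kan_low Q X Y \<phi> (kan_up Q X Y \<phi> \<rho>))"
  using qle_PSh_iff[OF Y \<rho> kan_low_PSh[OF kan_up_PSh[OF \<rho>]]] kan_up_PSh[OF \<rho>] \<rho>
    le_kan_low_iff[OF kan_up_PSh[OF \<rho>]] le_kan_up[OF \<rho>] PShD(2)[OF Y \<rho>] by simp

text \<open>Every term of the join for \<open>kan_up\<close> is bounded by \<mu>(x), by the
  inequality that characterises \<open>kan_low\<close>.\<close>

lemma kan_counit: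
  assumes \<mu>: "\<mu> \<in> pts (PSh Q X)"
  shows "qle Q (PSh Q X) (kan_up Q X Y \<phi> (kan_low Q X Y \<phi> \<mu>)) \<mu>"
  using qle_PSh_iff[OF X kan_up_PSh[OF kan_low_PSh[OF \<mu>]] \<mu>] kan_low_PSh[OF \<mu>] \<mu>
    kan_up_le_iff[OF kan_low_PSh[OF \<mu>]] kan_low_cmp_le[OF \<mu>] PShD(2)[OF X \<mu>] by simp

end

section \<open>Graphs and inverse images of presheaves\<close>

context quantaloid
begin

lemma distributor_graph:
  assumes X: "qcategory Q X" and Y: "qcategory Q Y" and f: "qfunctor Q X Y f"
  shows "distributor Q X Y (graph X Y f)"
proof (rule distributorI[OF X Y])
  note F = qfunctorD[OF f]
  show "graph X Y f \<in> extensional2 (pts X) (pts Y)" by (simp add: graph_def)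
  show "graph X Y f x y \<in> Hom Q (tp X x) (tp Y y)" if "x \<in> pts X" "y \<in> pts Y" for x y
    using qcategoryD(2)[OF Y F(2)] F(3) that by (simp add: graph_def)
  show "hm Y y y' \<bullet> graph X Y f x y \<preceq> graph X Y f x y'"
    if "x \<in> pts X" "y \<in> pts Y" "y' \<in> pts Y" for x y y'
    using qcategoryD(4)[OF Y F(2)] that by (simp add: graph_def)
  fix x x' y assume x: "x \<in> pts X" "x' \<in> pts X" and y: "y \<in> pts Y"
  have a: "hm Y (f x) y \<in> Hom Q (tp X x) (tp Y y)" and a': "hm Y (f x') y \<in> Hom Q (tp X x') (tp Y y)"
    and h: "hm Y (f x') (f x) \<in> Hom Q (tp X x') (tp X x)"
    using qcategoryD(2)[OF Y] F(2,3) x y by metis+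
  note g = qcategoryD(2)[OF X x(2,1)]
  show "graph X Y f x y \<bullet> hm X x' x \<preceq> graph X Y f x' y"
    using ale_trans[OF cmp_Hom[OF g a] cmp_Hom[OF h a] a' cmp_mono_right[OF g h a F(4)[OF x(2,1)]]
        qcategoryD(4)[OF Y F(2)[OF x(2)] F(2)[OF x(1)] y]] x y by (simp add: graph_def)
qed

text \<open>The value formula is a form of the Yoneda lemma. The join over y of \<nu>(y) \<circ> Y(f
  x, y) is bounded by \<nu>(f x) because \<nu> is a presheaf, and its term at y = f x reaches this
  bound because Y(f x, f x) lies above the identity. Later arguments use these four facts instead of
  the join.\<close>

lemma pullback:
  assumes X: "qcategory Q X" and Y: "qcategory Q Y" and f: "qfunctor Q X Y f"
  shows qfunctor_pullback: "qfunctor Q (PSh Q Y) (PSh Q X) (pullback Q X Y f)"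
    and pullback_PSh: "\<nu> \<in> pts (PSh Q Y) \<Longrightarrow> pullback Q X Y f \<nu> \<in> pts (PSh Q X)"
    and fst_pullback: "\<nu> \<in> pts (PSh Q Y) \<Longrightarrow> fst (pullback Q X Y f \<nu>) = fst \<nu>"
    and pval_pullback: "\<nu> \<in> pts (PSh Q Y) \<Longrightarrow> x \<in> pts X \<Longrightarrow>
      pval (pullback Q X Y f \<nu>) x = pval \<nu> (f x)"
proof -
  interpret G: qdistributor Q X Y "graph X Y f"
    using X Y distributor_graph[OF X Y f] by unfold_locales
  note F = qfunctorD[OF f]
  show "qfunctor Q (PSh Q Y) (PSh Q X) (pullback Q X Y f)"
    unfolding pullback_def by (rule G.qfunctor_kan_up)
  assume \<nu>: "\<nu> \<in> pts (PSh Q Y)"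
  show "pullback Q X Y f \<nu> \<in> pts (PSh Q X)" "fst (pullback Q X Y f \<nu>) = fst \<nu>"
    using G.kan_up_PSh \<nu> by (auto simp: pullback_def)
  assume x: "x \<in> pts X"
  have n: "pval \<nu> (f x) \<in> Hom Q (tp X x) (fst \<nu>)" using PShD(2)[OF Y \<nu> F(2)] F(3) x by metis
  have h: "hm Y (f x) (f x) \<in> Hom Q (tp X x) (tp X x)" using qcategoryD(2)[OF Y] F(2,3) x by metis
  have "pval (pullback Q X Y f \<nu>) x \<preceq> pval \<nu> (f x)"
    unfolding pullback_def G.kan_up_le_iff[OF \<nu> x n]
    using PShD(3)[OF Y \<nu> _ F(2)[OF x]] x by (simp add: graph_def)
  moreover have "pval \<nu> (f x) \<preceq> pval (pullback Q X Y f \<nu>) x"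
    by (rule ale_trans[OF n cmp_Hom[OF h n] _ le_hm_refl_cmp[OF Y F(2)[OF x]]])
      (use n F(2,3) x \<nu> G.pval_kan_up_Hom[OF \<nu> x] G.le_kan_up[OF \<nu> x F(2)[OF x]] in
        \<open>auto simp: graph_def pullback_def\<close>)
  ultimately show "pval (pullback Q X Y f \<nu>) x = pval \<nu> (f x)"
    using ale_antisym n G.pval_kan_up_Hom[OF \<nu> x] by (simp add: pullback_def)
qed

end

section \<open>Interior spaces\<close>

lemma pts_opens: "pts (opens Q (X, a)) = {\<mu> \<in> pts (PSh Q X). a \<mu> = \<mu>}"
  by (simp add: opens_def full_subcat_def)

lemma opens_simps [simp]:
  assumes "\<mu> \<in> pts (opens Q (X, a))" "\<nu> \<in> pts (opens Q (X, a))"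
  shows "tp (opens Q (X, a)) \<mu> = fst \<mu>"
    and "hm (opens Q (X, a)) \<mu> \<nu> = hm (PSh Q X) \<mu> \<nu>"
  using assms by (auto simp: opens_def full_subcat_def)

section \<open>Full subcategories, copies along an injection, and composition of functors\<close>

lemma qcategory_full_subcat:
  assumes "qcategory Q X" "A \<subseteq> pts X"
  shows "qcategory Q (full_subcat X A)"
  using qcategoryD[OF assms(1)] assms(2) subsetD[OF assms(2)]
  by (auto simp: qcategory_def full_subcat_def)

lemma pts_copy [simp]: "pts (copy e X) = e ` pts X"
  by (simp add: copy_def Let_def)

lemma copy_simps [simp]:
  assumes "inj_on e (pts X)" "x \<in> pts X" "y \<in> pts X"
  shows "tp (copy e X) (e x) = tp X x" and "hm (copy e X) (e x) (e y) = hm X x y"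
  using assms by (auto simp: copy_def Let_def)

lemma qcategory_copy:
  assumes X: "qcategory Q X" and e: "inj_on e (pts X)"
  shows "qcategory Q (copy e X)"
proof -
  have "tp (copy e X) \<in> extensional (pts (copy e X))"
    "hm (copy e X) \<in> extensional2 (pts (copy e X)) (pts (copy e X))"
    by (auto simp: copy_def Let_def)
  then show ?thesis
    using qcategoryD[OF X] e by (auto simp: qcategory_def PiE_def)
qed

lemma qfunctor_compose_id:
  assumes "qfunctor Q X Y f"
  shows "compose (pts X) f (\<lambda>x\<in>pts X. x) = f" and "compose (pts X) (\<lambda>y\<in>pts Y. y) f = f"
  using qfunctorD(1,2)[OF assms] by (auto intro: compose_Id[of f _ "pts Y"] Id_compose)

lemma qfunctor_compose_assoc:
  "qfunctor Q X Y f \<Longrightarrow>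
    compose (pts X) (compose (pts Y) h g) f = compose (pts X) h (compose (pts X) g f)"
  by (rule compose_assoc[symmetric]) (auto dest: qfunctorD(2))

lemma interior_spaceD:
  assumes "interior_space Q (X, a)"
  shows "qcategory Q X" and "qfunctor Q (PSh Q X) (PSh Q X) a"
    and "\<mu> \<in> pts (PSh Q X) \<Longrightarrow> a \<mu> \<in> pts (PSh Q X)"
    and "\<mu> \<in> pts (PSh Q X) \<Longrightarrow> fst (a \<mu>) = fst \<mu>"
    and "\<mu> \<in> pts (PSh Q X) \<Longrightarrow> qle Q (PSh Q X) (a \<mu>) \<mu>"
    and "\<mu> \<in> pts (PSh Q X) \<Longrightarrow> a (a \<mu>) = a \<mu>"
proof -
  show "qcategory Q X" and a: "qfunctor Q (PSh Q X) (PSh Q X) a"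
    using assms by (auto simp: interior_space_def)
  assume \<mu>: "\<mu> \<in> pts (PSh Q X)"
  show am: "a \<mu> \<in> pts (PSh Q X)" by (rule qfunctorD(2)[OF a \<mu>])
  show "fst (a \<mu>) = fst \<mu>" using qfunctorD(3)[OF a \<mu>] \<mu> am by simp
  show "qle Q (PSh Q X) (a \<mu>) \<mu>" using assms \<mu> by (simp add: interior_space_def qfun_le_def)
  show "a (a \<mu>) = a \<mu>" using assms \<mu> by (simp add: interior_space_def) (metis compose_eq)
qed

section \<open>Open presheaves and continuity\<close>

context quantaloid
begin

lemma interior_PSh_opens:
  "interior_space Q (X, a) \<Longrightarrow> \<mu> \<in> pts (PSh Q X) \<Longrightarrow> a \<mu> \<in> pts (opens Q (X, a))"
  by (simp add: pts_opens interior_spaceD)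

lemma qcategory_opens:
  assumes "interior_space Q (X, a)"
  shows "qcategory Q (opens Q (X, a))"
  unfolding opens_def
  using qcategory_full_subcat[OF qcategory_PSh[OF interior_spaceD(1)[OF assms]]] by simp

text \<open>The inequality a \<mu> \<le> \<mu> always holds and P X is separated, so the other
  inequality is enough.\<close>

lemma openI:
  assumes S: "interior_space Q (X, a)" and \<mu>: "\<mu> \<in> pts (PSh Q X)" and le: "qle Q (PSh Q X) \<mu> (a \<mu>)"
  shows "\<mu> \<in> pts (opens Q (X, a))"
  using qle_PSh_antisym[OF interior_spaceD(1)[OF S] interior_spaceD(3)[OF S \<mu>] \<mu> interior_spaceD(5)[OF S \<mu>] le] \<mu>
  by (simp add: pts_opens)

lemma pullback_id:
  assumes "qcategory Q X" "\<nu> \<in> pts (PSh Q X)"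
  shows "pullback Q X X (\<lambda>x\<in>pts X. x) \<nu> = \<nu>"
  by (rule PSh_eqI[OF pullback_PSh[OF assms(1,1) qfunctor_id[OF assms(1)] assms(2)] assms(2)])
    (use assms qfunctor_id[OF assms(1)] in \<open>simp_all add: fst_pullback pval_pullback\<close>)

lemma pullback_compose:
  assumes X: "qcategory Q X" and Y: "qcategory Q Y" and Z: "qcategory Q Z"
    and f: "qfunctor Q X Y f" and g: "qfunctor Q Y Z g" and \<nu>: "\<nu> \<in> pts (PSh Q Z)"
  shows "pullback Q X Z (compose (pts X) g f) \<nu> = pullback Q X Y f (pullback Q Y Z g \<nu>)"
proof -
  note gf = qfunctor_compose[OF X Y Z f g]
  show ?thesis
    by (rule PSh_eqI[OF pullback_PSh[OF X Z gf \<nu>] pullback_PSh[OF X Y f pullback_PSh[OF Y Z g \<nu>]]])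
      (simp_all add: fst_pullback[OF X Z gf \<nu>] fst_pullback[OF Y Z g \<nu>]
        fst_pullback[OF X Y f pullback_PSh[OF Y Z g \<nu>]] pval_pullback[OF X Z gf \<nu>]
        pval_pullback[OF Y Z g \<nu>] pval_pullback[OF X Y f pullback_PSh[OF Y Z g \<nu>]]
        compose_eq qfunctorD(2)[OF f])
qed

text \<open>From f x \<le> f' x follows \<nu>(f' x) \<le> \<nu>(f' x) \<circ> Y(f x, f' x) \<le>
  \<nu>(f x), since presheaves act contravariantly. This matches the reversed order on the second
  components of Chu transforms.\<close>

lemma pullback_antimono:
  assumes X: "qcategory Q X" and Y: "qcategory Q Y"
    and f: "qfunctor Q X Y f" "qfunctor Q X Y f'" and le: "qfun_le Q X Y f f'"
    and \<nu>: "\<nu> \<in> pts (PSh Q Y)"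
  shows "qle Q (PSh Q X) (pullback Q X Y f' \<nu>) (pullback Q X Y f \<nu>)"
  unfolding qle_PSh_iff[OF X pullback_PSh[OF X Y f(2) \<nu>] pullback_PSh[OF X Y f(1) \<nu>]]
proof (intro conjI ballI)
  show "fst (pullback Q X Y f' \<nu>) = fst (pullback Q X Y f \<nu>)"
    by (simp add: fst_pullback[OF X Y _ \<nu>] f)
  fix x assume x: "x \<in> pts X"
  note F = qfunctorD(2)[OF f(1) x] qfunctorD(2)[OF f(2) x]
  let ?p = "tp Y (f x)"
  have t: "tp Y (f' x) = ?p" using qfunctorD(3)[OF f(1) x] qfunctorD(3)[OF f(2) x] by simp
  have i: "idn Q ?p \<preceq> hm Y (f x) (f' x)" using le x unfolding qfun_le_def qle_def by blast
  have idn: "idn Q ?p \<in> Hom Q ?p ?p" using idn_Hom qcategoryD(1)[OF Y F(1)] by blast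
  have h: "hm Y (f x) (f' x) \<in> Hom Q ?p ?p" using qcategoryD(2)[OF Y F] t by simp
  have n': "pval \<nu> (f' x) \<in> Hom Q ?p (fst \<nu>)" using PShD(2)[OF Y \<nu> F(2)] t by simp
  note n = PShD(2)[OF Y \<nu> F(1)]
  have "pval \<nu> (f' x) \<preceq> pval \<nu> (f' x) \<bullet> hm Y (f x) (f' x)"
    using cmp_mono_right[OF idn h n' i] cmp_idn_right[OF n'] by simp
  then have "pval \<nu> (f' x) \<preceq> pval \<nu> (f x)"
    by (rule ale_trans[OF n' cmp_Hom[OF h n'] n]) (rule PShD(3)[OF Y \<nu> F(2,1)])
  then show "pval (pullback Q X Y f' \<nu>) x \<preceq> pval (pullback Q X Y f \<nu>) x"
    by (simp add: pval_pullback[OF X Y _ \<nu> x] f)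
qed

lemma continuous_functor_iff:
  "continuous_functor Q (X, a) (Y, b) f \<longleftrightarrow> qfunctor Q X Y f \<and>
    (\<forall>\<nu>\<in>pts (PSh Q Y). qle Q (PSh Q X) (pullback Q X Y f (b \<nu>)) (a (pullback Q X Y f \<nu>)))"
  by (simp add: continuous_functor_def qfun_le_def compose_eq)

lemma continuousD:
  assumes "continuous_functor Q (X, a) (Y, b) f"
  shows "qfunctor Q X Y f"
    and "\<nu> \<in> pts (PSh Q Y) \<Longrightarrow> qle Q (PSh Q X) (pullback Q X Y f (b \<nu>)) (a (pullback Q X Y f \<nu>))"
  using assms by (auto simp: continuous_functor_iff)

lemma continuous_id:
  assumes "interior_space Q (X, a)"
  shows "continuous_functor Q (X, a) (X, a) (\<lambda>x\<in>pts X. x)"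
  using interior_spaceD(1,3)[OF assms]
  by (simp add: continuous_functor_iff qfunctor_id pullback_id qle_refl qcategory_PSh)

text \<open>The chain is \<open>f\<^sup>\<leftarrow> g\<^sup>\<leftarrow> c \<le>
  f\<^sup>\<leftarrow> b g\<^sup>\<leftarrow> \<le> a f\<^sup>\<leftarrow>
  g\<^sup>\<leftarrow>\<close>, where the first inequality is continuity of g transported by the
  functor \<open>f\<^sup>\<leftarrow>\<close>.\<close>

lemma continuous_compose:
  assumes S: "interior_space Q (X, a)" and T: "interior_space Q (Y, b)" and V: "interior_space Q (Z, c)"
    and f: "continuous_functor Q (X, a) (Y, b) f" and g: "continuous_functor Q (Y, b) (Z, c) g"
  shows "continuous_functor Q (X, a) (Z, c) (compose (pts X) g f)"
  unfolding continuous_functor_iff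
proof (intro conjI ballI)
  note X = interior_spaceD(1)[OF S] and Y = interior_spaceD(1)[OF T] and Z = interior_spaceD(1)[OF V]
    and F = continuousD[OF f] and G = continuousD[OF g]
  show "qfunctor Q X Z (compose (pts X) g f)" by (rule qfunctor_compose[OF X Y Z F(1) G(1)])
  fix \<nu> assume \<nu>: "\<nu> \<in> pts (PSh Q Z)"
  note c\<nu> = interior_spaceD(3)[OF V \<nu>]
  note g\<nu> = pullback_PSh[OF Y Z G(1) \<nu>] and gc\<nu> = pullback_PSh[OF Y Z G(1) c\<nu>]
  note bg\<nu> = interior_spaceD(3)[OF T g\<nu>]
  show "qle Q (PSh Q X) (pullback Q X Z (compose (pts X) g f) (c \<nu>))
      (a (pullback Q X Z (compose (pts X) g f) \<nu>))"
    unfolding pullback_compose[OF X Y Z F(1) G(1) \<nu>] pullback_compose[OF X Y Z F(1) G(1) c\<nu>]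
    by (rule qle_trans[OF qcategory_PSh[OF X] pullback_PSh[OF X Y F(1) gc\<nu>]
        pullback_PSh[OF X Y F(1) bg\<nu>] interior_spaceD(3)[OF S pullback_PSh[OF X Y F(1) g\<nu>]]
        qfunctor_qle[OF qcategory_PSh[OF Y] qcategory_PSh[OF X] qfunctor_pullback[OF X Y F(1)]
          gc\<nu> bg\<nu> G(2)[OF \<nu>]] F(2)[OF g\<nu>]])
qed

text \<open>For b \<nu> = \<nu>, continuity at \<nu> is precisely the inequality that
  \<open>openI\<close> asks for.\<close>

lemma continuous_pullback_opens:
  assumes S: "interior_space Q (X, a)" and T: "interior_space Q (Y, b)"
    and f: "continuous_functor Q (X, a) (Y, b) f" and \<nu>: "\<nu> \<in> pts (opens Q (Y, b))"
  shows "pullback Q X Y f \<nu> \<in> pts (opens Q (X, a))"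
proof -
  have n: "\<nu> \<in> pts (PSh Q Y)" "b \<nu> = \<nu>" using \<nu> by (auto simp: pts_opens)
  show ?thesis
    using openI[OF S pullback_PSh[OF interior_spaceD(1)[OF S] interior_spaceD(1)[OF T] continuousD(1)[OF f] n(1)]]
      continuousD(2)[OF f n(1)] n(2) by simp
qed

text \<open>Since b \<nu> is open, \<open>f\<^sup>\<leftarrow> b \<nu> = a f\<^sup>\<leftarrow> b
  \<nu> \<le> a f\<^sup>\<leftarrow> \<nu>\<close>. This converse of
  \<open>continuous_pullback_opens\<close> is what recovers continuity from a Chu transform.\<close>

lemma continuous_functorI:
  assumes S: "interior_space Q (X, a)" and T: "interior_space Q (Y, b)" and f: "qfunctor Q X Y f"
    and opens: "\<And>\<nu>. \<nu> \<in> pts (opens Q (Y, b)) \<Longrightarrow> pullback Q X Y f \<nu> \<in> pts (opens Q (X, a))"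
  shows "continuous_functor Q (X, a) (Y, b) f"
  unfolding continuous_functor_iff
proof (intro conjI ballI f)
  note X = interior_spaceD(1)[OF S] and Y = interior_spaceD(1)[OF T]
  fix \<nu> assume \<nu>: "\<nu> \<in> pts (PSh Q Y)"
  note b\<nu> = interior_spaceD(3)[OF T \<nu>]
  have "qle Q (PSh Q X) (pullback Q X Y f (b \<nu>)) (pullback Q X Y f \<nu>)"
    by (rule qfunctor_qle[OF qcategory_PSh[OF Y] qcategory_PSh[OF X] qfunctor_pullback[OF X Y f]
        b\<nu> \<nu> interior_spaceD(5)[OF T \<nu>]])
  then have "qle Q (PSh Q X) (a (pullback Q X Y f (b \<nu>))) (a (pullback Q X Y f \<nu>))"
    by (rule qfunctor_qle[OF qcategory_PSh[OF X] qcategory_PSh[OF X] interior_spaceD(2)[OF S]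
        pullback_PSh[OF X Y f b\<nu>] pullback_PSh[OF X Y f \<nu>]])
  then show "qle Q (PSh Q X) (pullback Q X Y f (b \<nu>)) (a (pullback Q X Y f \<nu>))"
    using opens[OF interior_PSh_opens[OF T \<nu>]] by (simp add: pts_opens)
qed

end

section \<open>The locally ordered 2-category of interior spaces\<close>

lemma obs_QInt: "S \<in> obs (QInt Q \<U>) \<longleftrightarrow> interior_space Q S \<and> pts (fst S) \<in> \<U>"
  by (simp add: QInt_def Let_def)

lemma QInt_simps [simp]:
  "idn (QInt Q \<U>) S = (S, (\<lambda>x\<in>pts (fst S). x), S)"
  "(T, g, V) \<bullet>\<^bsub>QInt Q \<U>\<^esub> (S, f, T') = (S, compose (pts (fst S)) g f, V)"
  "(S, f, T) \<preceq>\<^bsub>QInt Q \<U>\<^esub> (S', f', T') \<longleftrightarrow> qfun_le Q (fst S) (fst T) f f'"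
  "src (QInt Q \<U>) (S, f, T) = S" "tgt (QInt Q \<U>) (S, f, T) = T"
  by (simp_all add: QInt_def Let_def)

lemma Hom_QInt: "u \<in> Hom (QInt Q \<U>) S T \<longleftrightarrow>
    S \<in> obs (QInt Q \<U>) \<and> T \<in> obs (QInt Q \<U>) \<and> (\<exists>f. u = (S, f, T) \<and> continuous_functor Q S T f)"
  by (auto simp: Hom_def QInt_def Let_def)

lemma (in quantaloid) ordered_category_QInt: "ordered_category (QInt Q \<U>)"
proof (rule ordered_category.intro)
  let ?C = "QInt Q \<U>"
  have I: "interior_space Q (fst S, snd S)" "qcategory Q (fst S)" if "S \<in> obs ?C" for S
    using that interior_spaceD(1)[of Q "fst S" "snd S"] by (simp_all add: obs_QInt)
  have C: "qfunctor Q (fst S) (fst T) f" if "continuous_functor Q S T f" for S T f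
    using that continuousD(1)[of "fst S" "snd S" "fst T" "snd T" f] by simp
  show "u \<in> arrs ?C \<Longrightarrow> src ?C u \<in> obs ?C" "u \<in> arrs ?C \<Longrightarrow> tgt ?C u \<in> obs ?C" for u
    by (auto simp: QInt_def Let_def)
  show "p \<in> obs ?C \<Longrightarrow> idn ?C p \<in> Hom ?C p p" for p
    using continuous_id[of "fst p" "snd p"] I(1) by (simp add: Hom_QInt)
  show "v \<bullet>\<^bsub>?C\<^esub> u \<in> Hom ?C p r" if "u \<in> Hom ?C p q" "v \<in> Hom ?C q r" for u v p q r
    using that continuous_compose[of "fst p" "snd p" "fst q" "snd q" "fst r" "snd r"] I(1)
    by (auto simp: Hom_QInt)
  show "u \<bullet>\<^bsub>?C\<^esub> idn ?C p = u" if "u \<in> Hom ?C p q" for u p q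
    using that by (auto simp: Hom_QInt qfunctor_compose_id[OF C])
  show "idn ?C q \<bullet>\<^bsub>?C\<^esub> u = u" if "u \<in> Hom ?C p q" for u p q
    using that by (auto simp: Hom_QInt qfunctor_compose_id[OF C])
  show "w \<bullet>\<^bsub>?C\<^esub> (v \<bullet>\<^bsub>?C\<^esub> u) = (w \<bullet>\<^bsub>?C\<^esub> v) \<bullet>\<^bsub>?C\<^esub> u"
    if "u \<in> Hom ?C p q" "v \<in> Hom ?C q r" "w \<in> Hom ?C r s" for u v w p q r s
    using that by (auto simp: Hom_QInt qfunctor_compose_assoc[OF C])
  show "u \<preceq>\<^bsub>?C\<^esub> u" if u: "u \<in> Hom ?C p q" for u p q
  proof -
    obtain f where f: "u = (p, f, q)" "continuous_functor Q p q f" "q \<in> obs ?C"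
      using u by (auto simp: Hom_QInt)
    then show ?thesis using qfun_le_refl[OF I(2)[OF f(3)] C[OF f(2)]] by simp
  qed
  show "u \<preceq>\<^bsub>?C\<^esub> w" if *: "u \<in> Hom ?C p q" "v \<in> Hom ?C p q" "w \<in> Hom ?C p q"
    and le: "u \<preceq>\<^bsub>?C\<^esub> v" "v \<preceq>\<^bsub>?C\<^esub> w" for u v w p q
  proof -
    obtain f g h where eqs: "u = (p, f, q)" "v = (p, g, q)" "w = (p, h, q)" and q: "q \<in> obs ?C"
      and f: "continuous_functor Q p q f" and g: "continuous_functor Q p q g"
      and h: "continuous_functor Q p q h"
      using * by (auto simp: Hom_QInt)
    show ?thesis
      using qfun_le_trans[OF I(2)[OF q] C[OF f] C[OF g] C[OF h]] le by (simp add: eqs)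
  qed
  show "v \<bullet>\<^bsub>?C\<^esub> u \<preceq>\<^bsub>?C\<^esub> v' \<bullet>\<^bsub>?C\<^esub> u'"
    if *: "u \<in> Hom ?C p q" "u' \<in> Hom ?C p q" "v \<in> Hom ?C q r" "v' \<in> Hom ?C q r"
      and le: "u \<preceq>\<^bsub>?C\<^esub> u'" "v \<preceq>\<^bsub>?C\<^esub> v'" for u u' v v' p q r
  proof -
    obtain f f' g g' where eqs: "u = (p, f, q)" "u' = (p, f', q)" "v = (q, g, r)" "v' = (q, g', r)"
      and obs: "p \<in> obs ?C" "q \<in> obs ?C" "r \<in> obs ?C"
      and f: "continuous_functor Q p q f" "continuous_functor Q p q f'"
      and g: "continuous_functor Q q r g" "continuous_functor Q q r g'"
      using * by (auto simp: Hom_QInt)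
    show ?thesis
      using qfun_le_compose[OF obs[THEN I(2)] f[THEN C] g[THEN C]] le by (simp add: eqs)
  qed
qed

section \<open>Chu transforms\<close>

lemma obs_QChu: "(X, \<phi>, Y) \<in> obs (QChu Q \<U> \<V>) \<longleftrightarrow> qcategory Q X \<and> qcategory Q Y \<and>
    distributor Q X Y \<phi> \<and> pts X \<in> \<U> \<and> pts Y \<in> \<V>"
  by (simp add: QChu_def Let_def)

lemma QChu_simps [simp]:
  "idn (QChu Q \<U> \<V>) (X, \<phi>, Y) = ((X, \<phi>, Y), (\<lambda>x\<in>pts X. x, \<lambda>y\<in>pts Y. y), (X, \<phi>, Y))"
  "(\<Psi>, (f', g'), (Z, \<zeta>, W)) \<bullet>\<^bsub>QChu Q \<U> \<V>\<^esub> ((X, \<phi>, Y), (f, g), \<Psi>') =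
    ((X, \<phi>, Y), (compose (pts X) f' f, compose (pts W) g g'), (Z, \<zeta>, W))"
  "((X, \<phi>, Y), (f, g), (X', \<psi>, Y')) \<preceq>\<^bsub>QChu Q \<U> \<V>\<^esub> (\<Phi>, (f', g'), \<Psi>) \<longleftrightarrow>
    qfun_le Q X X' f f' \<and> qfun_le Q Y' Y g' g"
  "src (QChu Q \<U> \<V>) (\<Phi>, h, \<Psi>) = \<Phi>" "tgt (QChu Q \<U> \<V>) (\<Phi>, h, \<Psi>) = \<Psi>"
  by (simp_all add: QChu_def Let_def dom_pts_def cod_pts_def)

lemma Hom_QChu: "u \<in> Hom (QChu Q \<U> \<V>) \<Phi> \<Psi> \<longleftrightarrow>
    \<Phi> \<in> obs (QChu Q \<U> \<V>) \<and> \<Psi> \<in> obs (QChu Q \<U> \<V>) \<and>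
    (\<exists>f g. u = (\<Phi>, (f, g), \<Psi>) \<and> chu_transform Q \<Phi> \<Psi> (f, g))"
  by (auto simp: Hom_def QChu_def Let_def)

lemma chu_transform_iff: "chu_transform Q (X, \<phi>, Y) (X', \<psi>, Y') (f, g) \<longleftrightarrow>
    qfunctor Q X X' f \<and> qfunctor Q Y' Y g \<and> (\<forall>x\<in>pts X. \<forall>y'\<in>pts Y'. \<psi> (f x) y' = \<phi> x (g y'))"
  by (simp add: chu_transform_def)

lemma (in quantaloid) chu_transform_id:
  assumes "qcategory Q X" "qcategory Q Y"
  shows "chu_transform Q (X, \<phi>, Y) (X, \<phi>, Y) (\<lambda>x\<in>pts X. x, \<lambda>y\<in>pts Y. y)"
  using assms by (simp add: chu_transform_iff qfunctor_id)

text \<open>The Chu condition is used once for each factor: \<zeta>(f' f x, w) = \<psi>(f x, g' w) =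
  \<phi>(x, g g' w).\<close>

lemma (in quantaloid) chu_transform_compose:
  assumes "qcategory Q X" "qcategory Q Y" "qcategory Q X'" "qcategory Q Y'" "qcategory Q Z" "qcategory Q W"
    and "chu_transform Q (X, \<phi>, Y) (X', \<psi>, Y') (f, g)"
    and "chu_transform Q (X', \<psi>, Y') (Z, \<zeta>, W) (f', g')"
  shows "chu_transform Q (X, \<phi>, Y) (Z, \<zeta>, W) (compose (pts X) f' f, compose (pts W) g g')"
  unfolding chu_transform_iff
proof (intro conjI ballI)
  show "\<zeta> (compose (pts X) f' f x) w = \<phi> x (compose (pts W) g g' w)"
    if "x \<in> pts X" "w \<in> pts W" for x w
  proof -
    have "f x \<in> pts X'" "g' w \<in> pts Y'"
      using assms(7,8) that by (auto simp: chu_transform_iff dest: qfunctorD(2))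
    then show ?thesis using assms(7,8) that by (simp add: chu_transform_iff compose_eq)
  qed
qed (use assms in \<open>auto simp: chu_transform_iff intro: qfunctor_compose\<close>)

text \<open>Second components are composed in the opposite order and compared in the opposite
  direction, so the same facts about functors serve both components.\<close>

lemma (in quantaloid) ordered_category_QChu: "ordered_category (QChu Q \<U> \<V>)"
proof (rule ordered_category.intro)
  let ?C = "QChu Q \<U> \<V>"
  show "u \<in> arrs ?C \<Longrightarrow> src ?C u \<in> obs ?C" "u \<in> arrs ?C \<Longrightarrow> tgt ?C u \<in> obs ?C" for u
    by (auto simp: QChu_def Let_def)
  show "p \<in> obs ?C \<Longrightarrow> idn ?C p \<in> Hom ?C p p" for p
    by (cases p) (simp add: Hom_QChu obs_QChu chu_transform_id)
  show "v \<bullet>\<^bsub>?C\<^esub> u \<in> Hom ?C p r" if "u \<in> Hom ?C p q" "v \<in> Hom ?C q r" for u v p q r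
    using that by (cases p; cases q; cases r) (auto simp: Hom_QChu obs_QChu intro: chu_transform_compose)
  show "u \<bullet>\<^bsub>?C\<^esub> idn ?C p = u" if "u \<in> Hom ?C p q" for u p q
    using that by (cases p; cases q) (auto simp: Hom_QChu chu_transform_iff qfunctor_compose_id)
  show "idn ?C q \<bullet>\<^bsub>?C\<^esub> u = u" if "u \<in> Hom ?C p q" for u p q
    using that by (cases p; cases q) (auto simp: Hom_QChu chu_transform_iff qfunctor_compose_id)
  show "w \<bullet>\<^bsub>?C\<^esub> (v \<bullet>\<^bsub>?C\<^esub> u) = (w \<bullet>\<^bsub>?C\<^esub> v) \<bullet>\<^bsub>?C\<^esub> u"
    if "u \<in> Hom ?C p q" "v \<in> Hom ?C q r" "w \<in> Hom ?C r s" for u v w p q r s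
    using that by (cases p; cases q; cases r; cases s)
      (auto simp: Hom_QChu chu_transform_iff qfunctor_compose_assoc)
  show "u \<preceq>\<^bsub>?C\<^esub> u" if "u \<in> Hom ?C p q" for u p q
    using that by (cases p; cases q)
      (auto simp: Hom_QChu obs_QChu chu_transform_iff intro: qfun_le_refl)
  show "u \<preceq>\<^bsub>?C\<^esub> w" if "u \<in> Hom ?C p q" "v \<in> Hom ?C p q" "w \<in> Hom ?C p q"
    "u \<preceq>\<^bsub>?C\<^esub> v" "v \<preceq>\<^bsub>?C\<^esub> w" for u v w p q
    using that by (cases p; cases q)
      (auto simp: Hom_QChu obs_QChu chu_transform_iff intro: qfun_le_trans)
  show "v \<bullet>\<^bsub>?C\<^esub> u \<preceq>\<^bsub>?C\<^esub> v' \<bullet>\<^bsub>?C\<^esub> u'"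
    if "u \<in> Hom ?C p q" "u' \<in> Hom ?C p q" "v \<in> Hom ?C q r" "v' \<in> Hom ?C q r"
      "u \<preceq>\<^bsub>?C\<^esub> u'" "v \<preceq>\<^bsub>?C\<^esub> v'" for u u' v v' p q r
    using that by (cases p; cases q; cases r)
      (auto simp: Hom_QChu obs_QChu chu_transform_iff intro: qfun_le_compose)
qed

section \<open>The 2-functor \<open>K\<close>\<close>

text \<open>The counit of the adjunction gives a \<le> 1. For a a = a, one inequality is the counit
  at a \<mu>, and the other is \<open>\<phi>\<^sup>*\<close> applied to the unit at
  \<open>\<phi>\<^sub>* \<mu>\<close>.\<close>

lemma (in qdistributor) interior_space_kan:
  "interior_space Q (K_obj Q (X, \<phi>, Y))"
proof -
  let ?P = "PSh Q X" and ?a = "compose (pts (PSh Q X)) (kan_up Q X Y \<phi>) (kan_low Q X Y \<phi>)"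
  note up = kan_up_PSh[OF kan_low_PSh] and PX = qcategory_PSh[OF X] and PY = qcategory_PSh[OF Y]
  have a: "?a \<mu> = kan_up Q X Y \<phi> (kan_low Q X Y \<phi> \<mu>)" if "\<mu> \<in> pts ?P" for \<mu>
    using that by (rule compose_eq)
  have idem: "?a (?a \<mu>) = ?a \<mu>" if \<mu>: "\<mu> \<in> pts ?P" for \<mu>
    unfolding a[OF \<mu>] a[OF up[OF \<mu>]]
  proof (rule qle_PSh_antisym[OF X up[OF up[OF \<mu>]] up[OF \<mu>] kan_counit[OF up[OF \<mu>]]])
    note l = kan_low_PSh[OF \<mu>]
    show "qle Q ?P (kan_up Q X Y \<phi> (kan_low Q X Y \<phi> \<mu>))
        (kan_up Q X Y \<phi> (kan_low Q X Y \<phi> (kan_up Q X Y \<phi> (kan_low Q X Y \<phi> \<mu>))))"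
      by (rule qfunctor_qle[OF PY PX qfunctor_kan_up l kan_low_PSh[OF kan_up_PSh[OF l]] kan_unit[OF l]])
  qed
  have "compose (pts ?P) ?a ?a = ?a"
    using idem by (auto simp: compose_def fun_eq_iff)
  then show ?thesis
    using qfunctor_compose[OF PX PY PX qfunctor_kan_low qfunctor_kan_up] kan_counit X
    by (simp add: interior_space_def K_obj_def qfun_le_def a)
qed

context quantaloid
begin

lemma qdistributorI:
  "qcategory Q X \<Longrightarrow> qcategory Q Y \<Longrightarrow> distributor Q X Y \<phi> \<Longrightarrow> qdistributor Q X Y \<phi>"
  by unfold_locales

lemma fst_K_obj [simp]: "fst (K_obj Q (X, \<phi>, Y)) = X"
  by (simp add: K_obj_def)

lemma K_obj_obs:
  "(X, \<phi>, Y) \<in> obs (QChu Q \<U> \<V>) \<Longrightarrow> K_obj Q (X, \<phi>, Y) \<in> obs (QInt Q \<U>)"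
  using qdistributor.interior_space_kan[OF qdistributorI] by (auto simp: obs_QInt obs_QChu)

text \<open>At x, both sides are joins, indexed by Y' and by Y. The map g sends the index y' to g
  y', and the term at y' on the left is shown to lie below the term at g y' on the right.\<close>

lemma chu_transform_continuous:
  assumes X: "qcategory Q X" and Y: "qcategory Q Y" and \<phi>: "distributor Q X Y \<phi>"
    and X': "qcategory Q X'" and Y': "qcategory Q Y'" and \<psi>: "distributor Q X' Y' \<psi>"
    and chu: "chu_transform Q (X, \<phi>, Y) (X', \<psi>, Y') (f, g)"
  shows "continuous_functor Q (K_obj Q (X, \<phi>, Y)) (K_obj Q (X', \<psi>, Y')) f"
proof -
  interpret D: qdistributor Q X Y \<phi> using X Y \<phi> by (rule qdistributorI)
  interpret D': qdistributor Q X' Y' \<psi> using X' Y' \<psi> by (rule qdistributorI)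
  have f: "qfunctor Q X X' f" and g: "qfunctor Q Y' Y g"
    and eq: "\<And>x y. x \<in> pts X \<Longrightarrow> y \<in> pts Y' \<Longrightarrow> \<psi> (f x) y = \<phi> x (g y)"
    using chu by (auto simp: chu_transform_iff)
  note F = qfunctorD[OF f] and G = qfunctorD[OF g]
  have "qle Q (PSh Q X) (pullback Q X X' f (kan_up Q X' Y' \<psi> (kan_low Q X' Y' \<psi> \<nu>)))
     (kan_up Q X Y \<phi> (kan_low Q X Y \<phi> (pullback Q X X' f \<nu>)))" if \<nu>: "\<nu> \<in> pts (PSh Q X')" for \<nu>
  proof -
    let ?m = "pullback Q X X' f \<nu>"
    note m = pullback_PSh[OF X X' f \<nu>] and l' = D'.kan_low_PSh[OF \<nu>]
    note u' = D'.kan_up_PSh[OF l'] and l = D.kan_low_PSh[OF m]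
    note u = D.kan_up_PSh[OF l]
    have t: "fst ?m = fst \<nu>" by (rule fst_pullback[OF X X' f \<nu>])
    have "pval (kan_up Q X' Y' \<psi> (kan_low Q X' Y' \<psi> \<nu>)) (f x)
        \<preceq> pval (kan_up Q X Y \<phi> (kan_low Q X Y \<phi> ?m)) x" (is "_ \<preceq> ?w") if x: "x \<in> pts X" for x
    proof -
      have w: "?w \<in> Hom Q (tp X' (f x)) (fst (kan_low Q X' Y' \<psi> \<nu>))"
        using PShD(2)[OF X u x] F(3)[OF x] D'.fst_kan_low[OF \<nu>] D.fst_kan_low[OF m]
          D.fst_kan_up[OF l] t by simp
      have "pval (kan_low Q X' Y' \<psi> \<nu>) y \<bullet> \<psi> (f x) y \<preceq> ?w" if y: "y \<in> pts Y'" for y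
      proof -
        let ?v = "pval (kan_low Q X' Y' \<psi> \<nu>) y" and ?v' = "pval (kan_low Q X Y \<phi> ?m) (g y)"
        have v: "?v \<in> Hom Q (tp Y (g y)) (fst ?m)"
          using D'.pval_kan_low_Hom[OF \<nu> y] t G(3)[OF y] by simp
        \<comment> \<open>The Chu condition replaces \<phi>(z, g y) by \<psi>(f z, y), and
          \<open>kan_low\<close> for \<psi> bounds the composite by \<nu>(f z), which is the value
          at z of the inverse image.\<close>
        have "?v \<bullet> \<phi> z (g y) \<preceq> pval ?m z" if z: "z \<in> pts X" for z
          using D'.kan_low_cmp_le[OF \<nu> y F(2)[OF z]] eq[OF z y] pval_pullback[OF X X' f \<nu> z] by simp
        then have "?v \<preceq> ?v'" using D.le_kan_low_iff[OF m G(2)[OF y] v] by blast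
        note a = distributorD(1)[OF \<phi> x G(2)[OF y]] and v' = D.pval_kan_low_Hom[OF m G(2)[OF y]]
        have w': "?w \<in> Hom Q (tp X x) (fst ?m)"
          using PShD(2)[OF X u x] D.fst_kan_low[OF m] D.fst_kan_up[OF l] by simp
        show ?thesis
          unfolding eq[OF x y]
          by (rule ale_trans[OF cmp_Hom[OF a v] cmp_Hom[OF a v'] w'
              cmp_mono_left[OF a v v' \<open>?v \<preceq> ?v'\<close>] D.le_kan_up[OF l x G(2)[OF y]]])
      qed
      then show ?thesis using D'.kan_up_le_iff[OF l' F(2)[OF x] w] by blast
    qed
    then show ?thesis
      using qle_PSh_iff[OF X pullback_PSh[OF X X' f u'] u] pval_pullback[OF X X' f u']
        fst_pullback[OF X X' f u'] t m l l' \<nu> by simp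
  qed
  then show ?thesis
    unfolding K_obj_def using f pullback_PSh[OF X X' f]
    by (simp add: continuous_functor_iff compose_eq)
qed

lemma two_functor_K: "two_functor (QChu Q \<U> \<V>) (QInt Q \<U>) (K_functor Q)"
  unfolding two_functor_def
proof (intro conjI ballI ordered_category_QChu ordered_category_QInt impI)
  let ?C = "QChu Q \<U> \<V>" and ?D = "QInt Q \<U>"
  fix \<Phi> assume \<Phi>: "\<Phi> \<in> obs ?C"
  show "fobj (K_functor Q) \<Phi> \<in> obs ?D"
    using \<Phi> by (cases \<Phi>) (simp add: K_functor_def K_obj_obs)
  show "farr (K_functor Q) (idn ?C \<Phi>) = idn ?D (fobj (K_functor Q) \<Phi>)"
    by (cases \<Phi>) (simp add: K_functor_def)
  fix \<Psi> u assume \<Psi>: "\<Psi> \<in> obs ?C" and u: "u \<in> Hom ?C \<Phi> \<Psi>"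
  show "farr (K_functor Q) u \<in> Hom ?D (fobj (K_functor Q) \<Phi>) (fobj (K_functor Q) \<Psi>)"
    using u by (cases \<Phi>; cases \<Psi>)
      (auto simp: K_functor_def Hom_QInt Hom_QChu K_obj_obs obs_QChu intro: chu_transform_continuous)
  show "farr (K_functor Q) u \<preceq>\<^bsub>?D\<^esub> farr (K_functor Q) v"
    if "v \<in> Hom ?C \<Phi> \<Psi>" "u \<preceq>\<^bsub>?C\<^esub> v" for v
    using u that by (cases \<Phi>; cases \<Psi>) (auto simp: K_functor_def Hom_QChu)
  fix \<Xi> v assume "\<Xi> \<in> obs ?C" "v \<in> Hom ?C \<Psi> \<Xi>"
  then show "farr (K_functor Q) (v \<bullet>\<^bsub>?C\<^esub> u) = farr (K_functor Q) v \<bullet>\<^bsub>?D\<^esub> farr (K_functor Q) u"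
    using u by (cases \<Phi>; cases \<Psi>; cases \<Xi>) (auto simp: K_functor_def Hom_QChu)
qed

end

section \<open>The 2-functor \<open>I\<close>\<close>

locale presheaf_universe = quantaloid Q
  for Q :: "('o, 'm) ocat" (structure) +
  fixes \<U> :: "'a set set" and \<V> :: "'b set set" and e :: "('a, 'o, 'm) psh \<Rightarrow> 'b"
  assumes admits: "admits_presheaves Q \<U> \<V> e"
begin

abbreviation "\<I> \<equiv> QInt Q \<U>"
abbreviation "\<C> \<equiv> QChu Q \<U> \<V>"
text \<open>This is \<open>\<kappa>\<^sub>a\<close> with the open presheaves renamed along
  \<open>e\<close>. Points of \<open>cod X a\<close> are treated as \<open>e \<nu>\<close> with
  \<nu> open, so that \<open>cod_simps\<close> removes the renaming.\<close>

abbreviation "ev X a \<equiv>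
  restrict2 (\<lambda>x m. pval (inv_into (pts (opens Q (X, a))) e m) x) (pts X) (e ` pts (opens Q (X, a)))"
abbreviation "cod X a \<equiv> copy e (opens Q (X, a))"

lemma obs_IntD: "(X, a) \<in> obs \<I> \<Longrightarrow> interior_space Q (X, a)" "(X, a) \<in> obs \<I> \<Longrightarrow> qcategory Q X"
  using interior_spaceD(1) by (auto simp: obs_QInt)

lemma inj_e: "(X, a) \<in> obs \<I> \<Longrightarrow> inj_on e (pts (PSh Q X))"
  using admits interior_spaceD(1)[of Q X a] by (simp add: admits_presheaves_def obs_QInt)

lemma inj_e_opens: "(X, a) \<in> obs \<I> \<Longrightarrow> inj_on e (pts (opens Q (X, a)))"
  by (rule inj_on_subset[OF inj_e]) (auto simp: pts_opens)

lemma opensD: "\<mu> \<in> pts (opens Q (X, a)) \<Longrightarrow> \<mu> \<in> pts (PSh Q X)"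
  by (simp add: pts_opens)

lemma inv_e [simp]:
  "(X, a) \<in> obs \<I> \<Longrightarrow> \<mu> \<in> pts (opens Q (X, a)) \<Longrightarrow> inv_into (pts (opens Q (X, a))) e (e \<mu>) = \<mu>"
  using inj_e_opens by simp

lemma cod_simps [simp]:
  assumes "(X, a) \<in> obs \<I>" "\<mu> \<in> pts (opens Q (X, a))"
  shows "tp (cod X a) (e \<mu>) = fst \<mu>"
    and "\<nu> \<in> pts (opens Q (X, a)) \<Longrightarrow> hm (cod X a) (e \<mu>) (e \<nu>) = hm (PSh Q X) \<mu> \<nu>"
    and "x \<in> pts X \<Longrightarrow> ev X a x (e \<mu>) = pval \<mu> x"
  using assms inj_e_opens[OF assms(1)] by simp_all

lemma qle_cod_iff:
  assumes "(X, a) \<in> obs \<I>" "\<mu> \<in> pts (opens Q (X, a))" "\<nu> \<in> pts (opens Q (X, a))"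
  shows "qle Q (cod X a) (e \<mu>) (e \<nu>) \<longleftrightarrow> qle Q (PSh Q X) \<mu> \<nu>"
  using assms opensD[OF assms(2)] opensD[OF assms(3)] by (simp add: qle_def)

lemma I_obj: "I_obj Q e (X, a) = (X, ev X a, cod X a)"
  by (simp add: I_obj_def Let_def)

lemma qcategory_cod: "(X, a) \<in> obs \<I> \<Longrightarrow> qcategory Q (cod X a)"
  by (rule qcategory_copy[OF qcategory_opens[OF obs_IntD(1)] inj_e_opens])

text \<open>The right action law is the presheaf law of each open presheaf; the left one is the
  evaluation inequality \<open>hm_PSh_cmp_le\<close>.\<close>

lemma distributor_ev:
  assumes S: "(X, a) \<in> obs \<I>"
  shows "distributor Q X (cod X a) (ev X a)"
proof (rule distributorI[OF _ qcategory_cod[OF S]])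
  show X: "qcategory Q X" by (rule obs_IntD(2)[OF S])
  show "ev X a \<in> extensional2 (pts X) (pts (cod X a))" by simp
  show "ev X a x m \<in> Hom Q (tp X x) (tp (cod X a) m)" if "x \<in> pts X" "m \<in> pts (cod X a)" for x m
    using that PShD(2)[OF X opensD] S by auto
  show "ev X a x m \<bullet> hm X x' x \<preceq> ev X a x' m"
    if "x \<in> pts X" "x' \<in> pts X" "m \<in> pts (cod X a)" for x x' m
    using that PShD(3)[OF X opensD] S by auto
  show "hm (cod X a) m m' \<bullet> ev X a x m \<preceq> ev X a x m'"
    if "x \<in> pts X" "m \<in> pts (cod X a)" "m' \<in> pts (cod X a)" for x m m'
    using that hm_PSh_cmp_le[OF X opensD opensD] S by auto
qed

text \<open>Membership in \<open>\<V>\<close> is where the closure of the universe under encoded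
  sets of presheaves enters.\<close>

lemma I_obj_obs:
  assumes S: "(X, a) \<in> obs \<I>"
  shows "I_obj Q e (X, a) \<in> obs \<C>"
proof -
  have "pts (opens Q (X, a)) \<subseteq> pts (PSh Q X)" by (rule subsetI, rule opensD)
  then have "e ` pts (opens Q (X, a)) \<in> \<V>"
    using admits S obs_IntD(2)[OF S]
    unfolding admits_presheaves_def obs_QInt fst_conv by blast
  then show ?thesis
    using S obs_IntD(2)[OF S] qcategory_cod[OF S] distributor_ev[OF S]
    by (simp add: obs_QChu I_obj obs_QInt)
qed

text \<open>The second component of \<open>I_arr\<close>, named in order to compare it with the
  second component of an arbitrary Chu transform.\<close>

definition pull :: "('a, 'o, 'm) ispace \<Rightarrow> ('a, 'o, 'm) ispace \<Rightarrow> ('a \<Rightarrow> 'a) \<Rightarrow> 'b \<Rightarrow> 'b" where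
  "pull S T f = (\<lambda>m \<in> e ` pts (opens Q T).
     e (pullback Q (fst S) (fst T) f (inv_into (pts (opens Q T)) e m)))"

lemma I_arr: "I_arr Q e (S, f, T) = (I_obj Q e S, (f, pull S T f), I_obj Q e T)"
  by (simp add: I_arr_def Let_def pull_def)

lemma pull_e [simp]:
  "(Y, b) \<in> obs \<I> \<Longrightarrow> \<nu> \<in> pts (opens Q (Y, b)) \<Longrightarrow>
    pull (X, a) (Y, b) f (e \<nu>) = e (pullback Q X Y f \<nu>)"
  by (simp add: pull_def)

lemma chu_transform_pull:
  assumes S: "(X, a) \<in> obs \<I>" and T: "(Y, b) \<in> obs \<I>"
    and f: "continuous_functor Q (X, a) (Y, b) f"
  shows "chu_transform Q (X, ev X a, cod X a) (Y, ev Y b, cod Y b) (f, pull (X, a) (Y, b) f)"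
proof -
  note X = obs_IntD(2)[OF S] and Y = obs_IntD(2)[OF T] and F = continuousD(1)[OF f]
  have op: "pullback Q X Y f \<nu> \<in> pts (opens Q (X, a))" if "\<nu> \<in> pts (opens Q (Y, b))" for \<nu>
    by (rule continuous_pullback_opens[OF obs_IntD(1)[OF S] obs_IntD(1)[OF T] f that])
  have "qfunctor Q (cod Y b) (cod X a) (pull (X, a) (Y, b) f)"
    unfolding qfunctor_def
  proof (intro conjI ballI)
    show "pull (X, a) (Y, b) f \<in> pts (cod Y b) \<rightarrow>\<^sub>E pts (cod X a)"
      using op T by (auto simp: pull_def)
    show "tp (cod X a) (pull (X, a) (Y, b) f m) = tp (cod Y b) m" if "m \<in> pts (cod Y b)" for m
      using that op S T fst_pullback[OF X Y F opensD] by auto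
    show "hm (cod Y b) m m' \<preceq> hm (cod X a) (pull (X, a) (Y, b) f m) (pull (X, a) (Y, b) f m')"
      if "m \<in> pts (cod Y b)" "m' \<in> pts (cod Y b)" for m m'
      using that op S T qfunctorD(4)[OF qfunctor_pullback[OF X Y F] opensD opensD] by auto
  qed
  moreover have "ev Y b (f x) m = ev X a x (pull (X, a) (Y, b) f m)"
    if "x \<in> pts X" "m \<in> pts (cod Y b)" for x m
    using that op S T pval_pullback[OF X Y F opensD] qfunctorD(2)[OF F] by auto
  ultimately show ?thesis using F by (simp add: chu_transform_iff)
qed

lemma chu_transform_is_pull:
  assumes S: "(X, a) \<in> obs \<I>" and T: "(Y, b) \<in> obs \<I>"
    and chu: "chu_transform Q (X, ev X a, cod X a) (Y, ev Y b, cod Y b) (f, g)"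
  shows "continuous_functor Q (X, a) (Y, b) f" and "g = pull (X, a) (Y, b) f"
proof -
  note X = obs_IntD(2)[OF S] and Y = obs_IntD(2)[OF T]
  have F: "qfunctor Q X Y f" and G: "qfunctor Q (cod Y b) (cod X a) g"
    and eq: "\<And>x m. x \<in> pts X \<Longrightarrow> m \<in> pts (cod Y b) \<Longrightarrow> ev Y b (f x) m = ev X a x (g m)"
    using chu by (auto simp: chu_transform_iff)
  \<comment> \<open>One comparison serves both claims. As a map into \<open>cod X a\<close>, g takes
    \<open>e \<nu>\<close> to \<open>e \<rho>\<close> with \<rho> open; identifying \<rho> with the
    inverse image of \<nu> shows that the latter is open and also determines g.\<close>
  have *: "pullback Q X Y f \<nu> \<in> pts (opens Q (X, a)) \<and> g (e \<nu>) = e (pullback Q X Y f \<nu>)"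
    if \<nu>: "\<nu> \<in> pts (opens Q (Y, b))" for \<nu>
  proof -
    have m: "e \<nu> \<in> pts (cod Y b)" using \<nu> by simp
    obtain \<rho> where \<rho>: "\<rho> \<in> pts (opens Q (X, a))" "g (e \<nu>) = e \<rho>"
      using qfunctorD(2)[OF G m] by auto
    have "\<rho> = pullback Q X Y f \<nu>"
    proof (rule PSh_eqI[OF opensD[OF \<rho>(1)] pullback_PSh[OF X Y F opensD[OF \<nu>]]])
      \<comment> \<open>The type is obtained from g being type-preserving; for empty X the Chu
        condition alone would say nothing.\<close>
      show "fst \<rho> = fst (pullback Q X Y f \<nu>)"
        using qfunctorD(3)[OF G m] \<rho> \<nu> S T fst_pullback[OF X Y F opensD[OF \<nu>]] by simp
      show "pval \<rho> x = pval (pullback Q X Y f \<nu>) x" if x: "x \<in> pts X" for x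
        using eq[OF x m] \<rho> \<nu> S T x pval_pullback[OF X Y F opensD[OF \<nu>] x] qfunctorD(2)[OF F x]
        by simp
    qed
    then show ?thesis using \<rho> by simp
  qed
  show "continuous_functor Q (X, a) (Y, b) f"
    by (rule continuous_functorI[OF obs_IntD(1)[OF S] obs_IntD(1)[OF T] F]) (use * in blast)
  show "g = pull (X, a) (Y, b) f"
  proof (rule extensionalityI)
    show "g \<in> extensional (pts (cod Y b))" by (rule qfunctorD(1)[OF G])
    show "pull (X, a) (Y, b) f \<in> extensional (pts (cod Y b))" by (simp add: pull_def)
    show "g m = pull (X, a) (Y, b) f m" if "m \<in> pts (cod Y b)" for m
      using that * T by auto
  qed
qed

lemma pull_id:
  assumes S: "(X, a) \<in> obs \<I>"
  shows "pull (X, a) (X, a) (\<lambda>x\<in>pts X. x) = (\<lambda>m\<in>pts (cod X a). m)"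
proof (rule extensionalityI)
  show "pull (X, a) (X, a) (\<lambda>x\<in>pts X. x) \<in> extensional (pts (cod X a))" by (simp add: pull_def)
  show "(\<lambda>m\<in>pts (cod X a). m) \<in> extensional (pts (cod X a))" by simp
  show "pull (X, a) (X, a) (\<lambda>x\<in>pts X. x) m = (\<lambda>m\<in>pts (cod X a). m) m" if "m \<in> pts (cod X a)" for m
    using that S pullback_id[OF obs_IntD(2)[OF S] opensD] by auto
qed

lemma pull_compose:
  assumes S: "(X, a) \<in> obs \<I>" and T: "(Y, b) \<in> obs \<I>" and V: "(Z, c) \<in> obs \<I>"
    and f: "continuous_functor Q (X, a) (Y, b) f" and g: "continuous_functor Q (Y, b) (Z, c) g"
  shows "pull (X, a) (Z, c) (compose (pts X) g f) =
    compose (pts (cod Z c)) (pull (X, a) (Y, b) f) (pull (Y, b) (Z, c) g)"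
proof (rule extensionalityI)
  show "pull (X, a) (Z, c) (compose (pts X) g f) \<in> extensional (pts (cod Z c))" by (simp add: pull_def)
  show "compose (pts (cod Z c)) (pull (X, a) (Y, b) f) (pull (Y, b) (Z, c) g)
      \<in> extensional (pts (cod Z c))" by simp
  fix m assume "m \<in> pts (cod Z c)"
  then obtain \<nu> where \<nu>: "\<nu> \<in> pts (opens Q (Z, c))" "m = e \<nu>" by auto
  have "pullback Q Y Z g \<nu> \<in> pts (opens Q (Y, b))"
    by (rule continuous_pullback_opens[OF obs_IntD(1)[OF T] obs_IntD(1)[OF V] g \<nu>(1)])
  then show "pull (X, a) (Z, c) (compose (pts X) g f) m =
    compose (pts (cod Z c)) (pull (X, a) (Y, b) f) (pull (Y, b) (Z, c) g) m"
    using \<nu> S T V pullback_compose[OF obs_IntD(2)[OF S] obs_IntD(2)[OF T] obs_IntD(2)[OF V]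
        continuousD(1)[OF f] continuousD(1)[OF g] opensD[OF \<nu>(1)]]
    by (simp add: compose_eq)
qed

lemma pull_antimono:
  assumes S: "(X, a) \<in> obs \<I>" and T: "(Y, b) \<in> obs \<I>"
    and f: "continuous_functor Q (X, a) (Y, b) f" "continuous_functor Q (X, a) (Y, b) f'"
    and le: "qfun_le Q X Y f f'"
  shows "qfun_le Q (cod Y b) (cod X a) (pull (X, a) (Y, b) f') (pull (X, a) (Y, b) f)"
  unfolding qfun_le_def
proof
  fix m assume "m \<in> pts (cod Y b)"
  then obtain \<nu> where \<nu>: "\<nu> \<in> pts (opens Q (Y, b))" "m = e \<nu>" by auto
  note op = continuous_pullback_opens[OF obs_IntD(1)[OF S] obs_IntD(1)[OF T] _ \<nu>(1)]
  show "qle Q (cod X a) (pull (X, a) (Y, b) f' m) (pull (X, a) (Y, b) f m)"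
    using \<nu> T pullback_antimono[OF obs_IntD(2)[OF S] obs_IntD(2)[OF T] continuousD(1)[OF f(1)]
        continuousD(1)[OF f(2)] le opensD[OF \<nu>(1)]]
    by (simp add: qle_cod_iff[OF S op[OF f(2)] op[OF f(1)]])
qed

lemma two_functor_I: "two_functor \<I> \<C> (I_functor Q e)"
  unfolding two_functor_def
proof (intro conjI ballI ordered_category_QChu ordered_category_QInt impI)
  fix S assume S: "S \<in> obs \<I>"
  show "fobj (I_functor Q e) S \<in> obs \<C>"
    using S I_obj_obs by (cases S) (simp add: I_functor_def)
  show "farr (I_functor Q e) (idn \<I> S) = idn \<C> (fobj (I_functor Q e) S)"
    using S by (cases S) (simp add: I_functor_def I_arr I_obj pull_id)
  fix T u assume T: "T \<in> obs \<I>" and u: "u \<in> Hom \<I> S T"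
  show "farr (I_functor Q e) u \<in> Hom \<C> (fobj (I_functor Q e) S) (fobj (I_functor Q e) T)"
    using u S T I_obj_obs chu_transform_pull by (cases S; cases T)
      (auto simp: I_functor_def I_arr I_obj Hom_QInt Hom_QChu)
  show "farr (I_functor Q e) u \<preceq>\<^bsub>\<C>\<^esub> farr (I_functor Q e) v"
    if "v \<in> Hom \<I> S T" "u \<preceq>\<^bsub>\<I>\<^esub> v" for v
    using u that by (cases S; cases T)
      (auto simp: I_functor_def I_arr I_obj Hom_QInt pull_antimono)
  fix V v assume V: "V \<in> obs \<I>" "v \<in> Hom \<I> T V"
  then show "farr (I_functor Q e) (v \<bullet>\<^bsub>\<I>\<^esub> u) = farr (I_functor Q e) v \<bullet>\<^bsub>\<C>\<^esub> farr (I_functor Q e) u"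
    using u S T pull_compose by (cases S; cases T; cases V)
      (auto simp: I_functor_def I_arr I_obj Hom_QInt)
qed

text \<open>Injectivity and reflection of the order are immediate because f survives as the first
  component. Surjectivity is \<open>chu_transform_is_pull\<close>, and preservation of the order is
  \<open>pull_antimono\<close>.\<close>

lemma fully_faithful_I: "fully_faithful \<I> \<C> (I_functor Q e)"
  unfolding fully_faithful_def
proof (intro ballI conjI)
  fix S T assume S: "S \<in> obs \<I>" and T: "T \<in> obs \<I>"
  obtain X a Y b where eqs: "S = (X, a)" "T = (Y, b)" by (cases S; cases T)
  show "bij_betw (farr (I_functor Q e)) (Hom \<I> S T)
      (Hom \<C> (fobj (I_functor Q e) S) (fobj (I_functor Q e) T))"
    unfolding bij_betw_def
  proof (intro conjI subset_antisym)
    show "inj_on (farr (I_functor Q e)) (Hom \<I> S T)"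
      by (auto simp: inj_on_def Hom_QInt I_functor_def I_arr)
    show "farr (I_functor Q e) ` Hom \<I> S T
        \<subseteq> Hom \<C> (fobj (I_functor Q e) S) (fobj (I_functor Q e) T)"
      using two_functor_I S T by (auto simp: two_functor_def)
    show "Hom \<C> (fobj (I_functor Q e) S) (fobj (I_functor Q e) T)
        \<subseteq> farr (I_functor Q e) ` Hom \<I> S T"
    proof
      fix h assume "h \<in> Hom \<C> (fobj (I_functor Q e) S) (fobj (I_functor Q e) T)"
      then obtain f g where h: "h = (I_obj Q e S, (f, g), I_obj Q e T)"
        and chu: "chu_transform Q (X, ev X a, cod X a) (Y, ev Y b, cod Y b) (f, g)"
        by (auto simp: Hom_QChu I_functor_def I_obj eqs)
      have "(S, f, T) \<in> Hom \<I> S T" "farr (I_functor Q e) (S, f, T) = h"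
        using chu_transform_is_pull[OF S[unfolded eqs] T[unfolded eqs] chu] S T
        by (simp_all add: Hom_QInt I_functor_def I_arr h eqs)
      then show "h \<in> farr (I_functor Q e) ` Hom \<I> S T" by (metis imageI)
    qed
  qed
  fix u v assume "u \<in> Hom \<I> S T" "v \<in> Hom \<I> S T"
  then show "u \<preceq>\<^bsub>\<I>\<^esub> v \<longleftrightarrow> farr (I_functor Q e) u \<preceq>\<^bsub>\<C>\<^esub> farr (I_functor Q e) v"
    using pull_antimono by (auto simp: eqs Hom_QInt I_functor_def I_arr I_obj)
qed

text \<open>The supremum over open \<open>\<nu>\<close> of \<open>P X(\<nu>, \<mu>) \<circ> \<nu>\<close> is \<open>a \<mu>\<close>: it is bounded by \<open>a \<mu>\<close> because
  \<open>P X(\<nu>, \<mu>) \<le> P X(a \<nu>, a \<mu>) = P X(\<nu>, a \<mu>)\<close>, and the bound is attained at \<open>\<nu> = a \<mu>\<close>.\<close>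

lemma K_I_obj:
  assumes S: "(X, a) \<in> obs \<I>"
  shows "K_obj Q (I_obj Q e (X, a)) = (X, a)"
proof -
  note iS = obs_IntD(1)[OF S] and X = obs_IntD(2)[OF S]
  interpret D: qdistributor Q X "cod X a" "ev X a"
    using X qcategory_cod[OF S] distributor_ev[OF S] by (rule qdistributorI)
  let ?up = "kan_up Q X (cod X a) (ev X a)" and ?low = "kan_low Q X (cod X a) (ev X a)"
  have low: "pval (?low \<mu>) (e \<nu>) = hm (PSh Q X) \<nu> \<mu>"
    if \<mu>: "\<mu> \<in> pts (PSh Q X)" and \<nu>: "\<nu> \<in> pts (opens Q (X, a))" for \<mu> \<nu>
  proof -
    note n = opensD[OF \<nu>]
    have m: "e \<nu> \<in> pts (cod X a)" using \<nu> by simp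
    have l: "pval (?low \<mu>) (e \<nu>) \<in> Hom Q (fst \<nu>) (fst \<mu>)"
      using D.pval_kan_low_Hom[OF \<mu> m] S \<nu> by simp
    note h = hm_PSh_Hom[OF X n \<mu>]
    \<comment> \<open>The entries of \<open>ev X a\<close> in the column of \<open>e \<nu>\<close>
      are the values of \<nu>, so \<open>kan_low\<close> and the hom of P X have the same universal
      property here.\<close>
    have iff: "v \<preceq> pval (?low \<mu>) (e \<nu>) \<longleftrightarrow> v \<preceq> hm (PSh Q X) \<nu> \<mu>"
      if v: "v \<in> Hom Q (fst \<nu>) (fst \<mu>)" for v
      using D.le_kan_low_iff[OF \<mu> m, of v] le_hm_PSh_iff[OF X n \<mu> v] v S \<nu> by simp
    show ?thesis
      using ale_antisym[OF l h] iff[OF l] iff[OF h] ale_refl[OF l] ale_refl[OF h] by blast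
  qed
  have "compose (pts (PSh Q X)) ?up ?low \<mu> = a \<mu>" if \<mu>: "\<mu> \<in> pts (PSh Q X)" for \<mu>
  proof -
    note l = D.kan_low_PSh[OF \<mu>]
    note u = D.kan_up_PSh[OF l] and am = interior_spaceD(3)[OF iS \<mu>]
      and ao = interior_PSh_opens[OF iS \<mu>]
    have t: "fst (?up (?low \<mu>)) = fst \<mu>" "fst (a \<mu>) = fst \<mu>"
      using l \<mu> interior_spaceD(4)[OF iS \<mu>] by simp_all
    have "?up (?low \<mu>) = a \<mu>"
    proof (rule PSh_eqI[OF u am])
      show "fst (?up (?low \<mu>)) = fst (a \<mu>)" using t by simp
      fix x assume x: "x \<in> pts X"
      have U: "pval (?up (?low \<mu>)) x \<in> Hom Q (tp X x) (fst \<mu>)" using PShD(2)[OF X u x] t by simp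
      have A: "pval (a \<mu>) x \<in> Hom Q (tp X x) (fst \<mu>)" using PShD(2)[OF X am x] t by simp
      have A': "pval (a \<mu>) x \<in> Hom Q (tp X x) (fst (?low \<mu>))" using A \<mu> by simp
      have "pval (?low \<mu>) m \<bullet> ev X a x m \<preceq> pval (a \<mu>) x" if m: "m \<in> pts (cod X a)" for m
      proof -
        obtain \<nu> where \<nu>: "\<nu> \<in> pts (opens Q (X, a))" "m = e \<nu>" using m by auto
        note n = opensD[OF \<nu>(1)]
        have an: "a \<nu> = \<nu>" using \<nu>(1) by (simp add: pts_opens)
        have le: "hm (PSh Q X) \<nu> \<mu> \<preceq> hm (PSh Q X) \<nu> (a \<mu>)"
          using qfunctorD(4)[OF interior_spaceD(2)[OF iS] n \<mu>] an by simp
        have H: "hm (PSh Q X) \<nu> (a \<mu>) \<in> Hom Q (fst \<nu>) (fst \<mu>)"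
          using hm_PSh_Hom[OF X n am] t by simp
        note v = PShD(2)[OF X n x] and H0 = hm_PSh_Hom[OF X n \<mu>]
        have "hm (PSh Q X) \<nu> \<mu> \<bullet> pval \<nu> x \<preceq> pval (a \<mu>) x"
          by (rule ale_trans[OF cmp_Hom[OF v H0] cmp_Hom[OF v H] A cmp_mono_left[OF v H0 H le]
              hm_PSh_cmp_le[OF X n am x]])
        then show ?thesis using low[OF \<mu> \<nu>(1)] \<nu> S x by simp
      qed
      then have 1: "pval (?up (?low \<mu>)) x \<preceq> pval (a \<mu>) x" using D.kan_up_le_iff[OF l x A'] by blast
      \<comment> \<open>The inequality a \<mu> \<le> \<mu> says that the hom from a \<mu> to \<mu>
        lies above the identity, so the term of the join indexed by a \<mu> is at least a
        \<mu>.\<close>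
      have i: "idn Q (fst \<mu>) \<preceq> hm (PSh Q X) (a \<mu>) \<mu>"
        using interior_spaceD(5)[OF iS \<mu>] unfolding qle_def tp_PSh[OF am] t(2) by blast
      have idn: "idn Q (fst \<mu>) \<in> Hom Q (fst \<mu>) (fst \<mu>)" using idn_Hom PShD(1)[OF X \<mu>] by blast
      have h: "hm (PSh Q X) (a \<mu>) \<mu> \<in> Hom Q (fst \<mu>) (fst \<mu>)"
        using hm_PSh_Hom[OF X am \<mu>] t by simp
      have "pval (a \<mu>) x \<preceq> hm (PSh Q X) (a \<mu>) \<mu> \<bullet> pval (a \<mu>) x"
        using cmp_mono_left[OF A idn h i] cmp_idn_left[OF A] by simp
      moreover have "hm (PSh Q X) (a \<mu>) \<mu> \<bullet> pval (a \<mu>) x \<preceq> pval (?up (?low \<mu>)) x"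
        using D.le_kan_up[OF l x, of "e (a \<mu>)"] low[OF \<mu> ao] ao S x by simp
      ultimately have 2: "pval (a \<mu>) x \<preceq> pval (?up (?low \<mu>)) x"
        using ale_trans[OF A cmp_Hom[OF A h] U] by blast
      show "pval (?up (?low \<mu>)) x = pval (a \<mu>) x" by (rule ale_antisym[OF U A 1 2])
    qed
    then show ?thesis using \<mu> by (simp add: compose_eq)
  qed
  then have "compose (pts (PSh Q X)) ?up ?low = a"
    using qfunctorD(1)[OF interior_spaceD(2)[OF iS]]
    by (intro extensionalityI[of _ "pts (PSh Q X)"]) auto
  then show ?thesis by (simp add: I_obj K_obj_def)
qed

lemma left_inverse_I_K: "left_inverse \<I> (I_functor Q e) (K_functor Q)"
proof -
  have obj: "K_obj Q (I_obj Q e S) = S" if "S \<in> obs \<I>" for S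
    using that K_I_obj by (cases S) simp
  have "farr (K_functor Q) (farr (I_functor Q e) u) = u" if "u \<in> arrs \<I>" for u
  proof -
    have "u \<in> Hom \<I> (src \<I> u) (tgt \<I> u)" using that by (simp add: Hom_def)
    then obtain S f T where "u = (S, f, T)" "S \<in> obs \<I>" "T \<in> obs \<I>" unfolding Hom_QInt by blast
    then show ?thesis using obj by (simp add: I_functor_def K_functor_def I_arr)
  qed
  then show ?thesis
    using obj by (simp add: left_inverse_def functor_eq_def comp_functor_def id_functor_def
        I_functor_def K_functor_def)
qed

section \<open>The counit\<close>

text \<open>The presheaf \<phi>(-, y), equal to Y(-, y) \<circ> \<phi>; its type is that of
  y.\<close>

definition column :: "('a, 'o, 'm) qcat \<Rightarrow> ('a \<Rightarrow> 'b \<Rightarrow> 'm) \<Rightarrow> ('b, 'o, 'm) qcat \<Rightarrow> 'b \<Rightarrow> ('a, 'o, 'm) psh" where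
  "column X \<phi> Y y = (tp Y y, restrict2 (\<lambda>x _. \<phi> x y) (pts X) {()})"

lemma column_simps [simp]:
  "fst (column X \<phi> Y y) = tp Y y" "x \<in> pts X \<Longrightarrow> pval (column X \<phi> Y y) x = \<phi> x y"
  by (simp_all add: column_def pval_def)

definition counit :: "('a, 'b, 'o, 'm) dist \<Rightarrow>
    ('a, 'b, 'o, 'm) dist \<times> (('a \<Rightarrow> 'a) \<times> ('b \<Rightarrow> 'b)) \<times> ('a, 'b, 'o, 'm) dist" where
  "counit = (\<lambda>(X, \<phi>, Y). (I_obj Q e (K_obj Q (X, \<phi>, Y)),
     (\<lambda>x\<in>pts X. x, \<lambda>y\<in>pts Y. e (column X \<phi> Y y)), (X, \<phi>, Y)))"

context
  fixes X :: "('a, 'o, 'm) qcat" and Y :: "('b, 'o, 'm) qcat" and \<phi>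
  assumes obs: "(X, \<phi>, Y) \<in> obs \<C>"
begin

interpretation D: qdistributor Q X Y \<phi>
  using obs by (intro qdistributorI) (simp_all add: obs_QChu)

private lemmas X = D.X and Y = D.Y and \<phi> = D.dist

lemma column_PSh:
  assumes y: "y \<in> pts Y"
  shows "column X \<phi> Y y \<in> pts (PSh Q X)"
  unfolding column_def
  by (rule PShI[OF X]) (use qcategoryD(1)[OF Y y] distributorD(1)[OF \<phi> _ y]
      distributor_right[OF X Y \<phi> _ _ y] y in simp_all)

text \<open>The join giving \<open>\<phi>\<^sup>*\<phi>\<^sub>* \<phi>(-, y)\<close> at x contains
  the term at y, which is \<phi>(x, y) composed with an arrow above the identity. The reverse
  inequality is \<open>kan_counit\<close>.\<close>

lemma column_open:
  assumes y: "y \<in> pts Y"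
  shows "column X \<phi> Y y \<in> pts (opens Q (K_obj Q (X, \<phi>, Y)))"
proof -
  let ?c = "column X \<phi> Y y" and ?up = "kan_up Q X Y \<phi>" and ?low = "kan_low Q X Y \<phi>"
  note c = column_PSh[OF y]
  note l = D.kan_low_PSh[OF c]
  note u = D.kan_up_PSh[OF l]
  note q = qcategoryD(1)[OF Y y]
  have idn: "idn Q (tp Y y) \<in> Hom Q (tp Y y) (fst ?c)" using idn_Hom[OF q] by simp
  have L: "pval (?low ?c) y \<in> Hom Q (tp Y y) (tp Y y)" using D.pval_kan_low_Hom[OF c y] by simp
  have i: "idn Q (tp Y y) \<preceq> pval (?low ?c) y"
    unfolding D.le_kan_low_iff[OF c y idn]
    using cmp_idn_left[OF distributorD(1)[OF \<phi> _ y]] ale_refl[OF distributorD(1)[OF \<phi> _ y]] by simp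
  have "pval ?c x \<preceq> pval (?up (?low ?c)) x" if x: "x \<in> pts X" for x
  proof -
    note a = distributorD(1)[OF \<phi> x y]
    have U: "pval (?up (?low ?c)) x \<in> Hom Q (tp X x) (tp Y y)" using PShD(2)[OF X u x] l c by simp
    have "\<phi> x y \<preceq> pval (?low ?c) y \<bullet> \<phi> x y"
      using cmp_mono_left[OF a idn_Hom[OF q] L i] cmp_idn_left[OF a] by simp
    then have "\<phi> x y \<preceq> pval (?up (?low ?c)) x"
      by (rule ale_trans[OF a cmp_Hom[OF a L] U _ D.le_kan_up[OF l x y]])
    then show ?thesis using x by simp
  qed
  then have "qle Q (PSh Q X) ?c (?up (?low ?c))"
    using qle_PSh_iff[OF X c u] c l by simp
  then have "?up (?low ?c) = ?c"
    by (rule qle_PSh_antisym[OF X u c D.kan_counit[OF c]])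
  then show ?thesis using c by (simp add: K_obj_def pts_opens compose_eq)
qed

lemma counit_Hom: "counit (X, \<phi>, Y) \<in> Hom \<C> (I_obj Q e (K_obj Q (X, \<phi>, Y))) (X, \<phi>, Y)"
proof -
  obtain a where K: "K_obj Q (X, \<phi>, Y) = (X, a)" by (simp add: K_obj_def)
  have S: "(X, a) \<in> obs \<I>" using K_obj_obs[OF obs] K by simp
  have op: "column X \<phi> Y y \<in> pts (opens Q (X, a))" if "y \<in> pts Y" for y
    using column_open[OF that] K by simp
  have "qfunctor Q Y (cod X a) (\<lambda>y\<in>pts Y. e (column X \<phi> Y y))"
    unfolding qfunctor_def
  proof (intro conjI ballI)
    show "(\<lambda>y\<in>pts Y. e (column X \<phi> Y y)) \<in> pts Y \<rightarrow>\<^sub>E pts (cod X a)" using op by auto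
    show "tp (cod X a) ((\<lambda>y\<in>pts Y. e (column X \<phi> Y y)) y) = tp Y y" if "y \<in> pts Y" for y
      using that S op by simp
    fix y y' assume y: "y \<in> pts Y" "y' \<in> pts Y"
    \<comment> \<open>Tested on values, this is the left action law of \<phi>.\<close>
    have "hm Y y y' \<preceq> hm (PSh Q X) (column X \<phi> Y y) (column X \<phi> Y y')"
      using le_hm_PSh_iff[OF X column_PSh[OF y(1)] column_PSh[OF y(2)], of "hm Y y y'"]
        qcategoryD(2)[OF Y y] distributor_left[OF X Y \<phi> _ y] by simp
    then show "hm Y y y' \<preceq> hm (cod X a) ((\<lambda>y\<in>pts Y. e (column X \<phi> Y y)) y)
        ((\<lambda>y\<in>pts Y. e (column X \<phi> Y y)) y')"
      using y S op by simp
  qed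
  then have "chu_transform Q (X, ev X a, cod X a) (X, \<phi>, Y)
      (\<lambda>x\<in>pts X. x, \<lambda>y\<in>pts Y. e (column X \<phi> Y y))"
    using qfunctor_id[OF X] S op by (simp add: chu_transform_iff)
  then show ?thesis
    using obs I_obj_obs[OF S] by (simp add: counit_def Hom_QChu K I_obj)
qed

end

text \<open>Both composites have first component f. Their second components agree by the Chu
  condition, since \<phi>(-, g y) is the inverse image along f of \<psi>(-, y).\<close>

lemma counit_natural:
  assumes \<Phi>: "(X, \<phi>, Y) \<in> obs \<C>" and \<Psi>: "(X', \<psi>, Y') \<in> obs \<C>"
    and chu: "chu_transform Q (X, \<phi>, Y) (X', \<psi>, Y') (f, g)"
  shows "((X, \<phi>, Y), (f, g), (X', \<psi>, Y')) \<bullet>\<^bsub>\<C>\<^esub> counit (X, \<phi>, Y) =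
    counit (X', \<psi>, Y') \<bullet>\<^bsub>\<C>\<^esub>
      I_arr Q e (K_obj Q (X, \<phi>, Y), f, K_obj Q (X', \<psi>, Y'))"
proof -
  obtain a b where K: "K_obj Q (X, \<phi>, Y) = (X, a)" "K_obj Q (X', \<psi>, Y') = (X', b)"
    by (simp add: K_obj_def)
  have S: "(X, a) \<in> obs \<I>" and T: "(X', b) \<in> obs \<I>"
    using K_obj_obs[OF \<Phi>] K_obj_obs[OF \<Psi>] K by simp_all
  have f: "qfunctor Q X X' f" and g: "qfunctor Q Y' Y g"
    and eq: "\<And>x y. x \<in> pts X \<Longrightarrow> y \<in> pts Y' \<Longrightarrow> \<psi> (f x) y = \<phi> x (g y)"
    using chu by (auto simp: chu_transform_iff)
  note X = obs_IntD(2)[OF S] and X' = obs_IntD(2)[OF T]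
  have "e (column X \<phi> Y (g y)) = pull (X, a) (X', b) f (e (column X' \<psi> Y' y))"
    if y: "y \<in> pts Y'" for y
  proof -
    note c = column_PSh[OF \<Phi> qfunctorD(2)[OF g y]] and c' = column_PSh[OF \<Psi> y]
    have op: "column X' \<psi> Y' y \<in> pts (opens Q (X', b))" using column_open[OF \<Psi> y] K by simp
    have "column X \<phi> Y (g y) = pullback Q X X' f (column X' \<psi> Y' y)"
      by (rule PSh_eqI[OF c pullback_PSh[OF X X' f c']])
        (simp_all add: fst_pullback[OF X X' f c'] pval_pullback[OF X X' f c'] qfunctorD(2)[OF f]
          qfunctorD(3)[OF g y] eq[OF _ y])
    then show ?thesis using T op by simp
  qed
  then have "compose (pts Y') (\<lambda>y\<in>pts Y. e (column X \<phi> Y y)) g =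
      compose (pts Y') (pull (X, a) (X', b) f) (\<lambda>y\<in>pts Y'. e (column X' \<psi> Y' y))"
    using qfunctorD(2)[OF g] by (auto simp: compose_def fun_eq_iff)
  then show ?thesis
    using qfunctor_compose_id[OF f] by (simp add: counit_def K I_arr I_obj)
qed

text \<open>In the first triangle, the counit at an object of the form \<open>I S\<close> is an
  identity, because the column of \<open>\<kappa>\<^sub>a\<close> at an open \<nu> is \<nu>. In the
  second, \<open>K\<close> discards the second component of the counit and leaves the identity on
  X.\<close>

lemma two_adjunction_I_K: "two_adjunction \<I> \<C> (I_functor Q e) (K_functor Q)"
  unfolding two_adjunction_def
proof (intro conjI exI two_functor_I two_functor_K)
  have KI: "K_obj Q (I_obj Q e S) = S" if "S \<in> obs \<I>" for S
    using that K_I_obj by (cases S) simp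
  interpret I: ordered_category \<I> by (rule ordered_category_QInt)
  \<comment> \<open>With \<open>K I\<close> the identity, naturality reduces to the unit laws;
    \<open>QInt_simps\<close> is removed so that \<open>idn \<I>\<close> keeps the form in which
    these laws are stated.\<close>
  show "nat_transf \<I> \<I> id_functor (comp_functor (K_functor Q) (I_functor Q e)) (idn \<I>)"
    using KI I.idn_Hom I.cmp_idn_left I.cmp_idn_right
    by (auto simp: nat_transf_def id_functor_def comp_functor_def K_functor_def I_functor_def I_arr
        Hom_QInt simp del: QInt_simps)
  show "nat_transf \<C> \<C> (comp_functor (I_functor Q e) (K_functor Q)) id_functor counit"
    unfolding nat_transf_def
  proof (intro conjI ballI)
    fix \<Phi> assume \<Phi>: "\<Phi> \<in> obs \<C>"
    then show "counit \<Phi> \<in> Hom \<C> (fobj (comp_functor (I_functor Q e) (K_functor Q)) \<Phi>)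
        (fobj id_functor \<Phi>)"
      using counit_Hom by (cases \<Phi>) (simp add: comp_functor_def id_functor_def I_functor_def K_functor_def)
    fix \<Psi> u assume "\<Psi> \<in> obs \<C>" "u \<in> Hom \<C> \<Phi> \<Psi>"
    then show "farr id_functor u \<bullet>\<^bsub>\<C>\<^esub> counit \<Phi> =
        counit \<Psi> \<bullet>\<^bsub>\<C>\<^esub> farr (comp_functor (I_functor Q e) (K_functor Q)) u"
      using \<Phi> counit_natural by (cases \<Phi>; cases \<Psi>)
        (auto simp: Hom_QChu comp_functor_def id_functor_def I_functor_def K_functor_def)
  qed
  show "\<forall>S\<in>obs \<I>. counit (fobj (I_functor Q e) S) \<bullet>\<^bsub>\<C>\<^esub> farr (I_functor Q e) (idn \<I> S) =
      idn \<C> (fobj (I_functor Q e) S)"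
  proof
    fix S assume S: "S \<in> obs \<I>"
    obtain X a where eq: "S = (X, a)" by (cases S)
    note S = S[unfolded eq] and X = obs_IntD(2)[OF S[unfolded eq]]
    have "e (column X (ev X a) (cod X a) m) = m" if "m \<in> pts (cod X a)" for m
    proof -
      obtain \<nu> where \<nu>: "\<nu> \<in> pts (opens Q (X, a))" "m = e \<nu>" using \<open>m \<in> pts (cod X a)\<close> by auto
      have "column X (ev X a) (cod X a) m = \<nu>"
        by (rule PSh_eqI[OF column_PSh[OF I_obj_obs[OF S, unfolded I_obj] that] opensD[OF \<nu>(1)]])
          (use \<nu> S in simp_all)
      then show ?thesis using \<nu> by simp
    qed
    then have "compose (pts (cod X a)) (\<lambda>m\<in>pts (cod X a). m)
        (\<lambda>m\<in>pts (cod X a). e (column X (ev X a) (cod X a) m)) = (\<lambda>m\<in>pts (cod X a). m)"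
      by (auto simp: compose_def fun_eq_iff)
    then show "counit (fobj (I_functor Q e) S) \<bullet>\<^bsub>\<C>\<^esub> farr (I_functor Q e) (idn \<I> S) =
      idn \<C> (fobj (I_functor Q e) S)"
      using KI[OF S] S qfunctor_compose_id[OF qfunctor_id[OF X]]
      by (simp add: I_functor_def I_arr counit_def I_obj eq pull_id del: pts_copy)
  qed
  show "\<forall>\<Phi>\<in>obs \<C>. farr (K_functor Q) (counit \<Phi>) \<bullet>\<^bsub>\<I>\<^esub> idn \<I> (fobj (K_functor Q) \<Phi>) =
      idn \<I> (fobj (K_functor Q) \<Phi>)"
  proof
    fix \<Phi> assume \<Phi>: "\<Phi> \<in> obs \<C>"
    obtain X \<phi> Y where eq: "\<Phi> = (X, \<phi>, Y)" by (cases \<Phi>)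
    have X: "qcategory Q X" using \<Phi> by (simp add: eq obs_QChu)
    show "farr (K_functor Q) (counit \<Phi>) \<bullet>\<^bsub>\<I>\<^esub> idn \<I> (fobj (K_functor Q) \<Phi>) =
      idn \<I> (fobj (K_functor Q) \<Phi>)"
      using KI[OF K_obj_obs[OF \<Phi>[unfolded eq]]] qfunctor_compose_id[OF qfunctor_id[OF X]]
      by (simp add: eq K_functor_def counit_def)
  qed
qed

lemma inj_on_I_obj: "inj_on (fobj (I_functor Q e)) (obs \<I>)"
  using left_inverse_I_K
  by (intro inj_on_inverseI[of _ "fobj (K_functor Q)"])
    (simp add: left_inverse_def functor_eq_def comp_functor_def id_functor_def)

end

theorem theorem4p5:
  fixes Q :: "('o, 'm) ocat"
    and \<U> :: "'a set set" and \<V> :: "'b set set"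
    and e :: "('a, 'o, 'm) psh \<Rightarrow> 'b"
  assumes "quantaloid Q"
    and "admits_presheaves Q \<U> \<V> e"
  shows "two_functor (QChu Q \<U> \<V>) (QInt Q \<U>) (K_functor Q)
    \<and> two_functor (QInt Q \<U>) (QChu Q \<U> \<V>) (I_functor Q e)
    \<and> left_inverse (QInt Q \<U>) (I_functor Q e) (K_functor Q)
    \<and> fully_faithful (QInt Q \<U>) (QChu Q \<U> \<V>) (I_functor Q e)
    \<and> two_adjunction (QInt Q \<U>) (QChu Q \<U> \<V>) (I_functor Q e) (K_functor Q)
    \<and> retract_of (QInt Q \<U>) (QChu Q \<U> \<V>)
    \<and> coreflective_via (QInt Q \<U>) (QChu Q \<U> \<V>) (I_functor Q e)"
proof -
  interpret quantaloid Q by (rule assms(1))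
  interpret presheaf_universe Q \<U> \<V> e by unfold_locales (rule assms(2))
  show ?thesis
    using two_functor_K two_functor_I left_inverse_I_K fully_faithful_I two_adjunction_I_K inj_on_I_obj
    unfolding retract_of_def coreflective_via_def by blast
qed

end
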